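(* Let $\Gamma\subset\mathbb{C}$ be a closed Jordan curve and let $f$ be a conformal map of the unit disc $\mathbb{D}$ onto the interior domain of $\Gamma$, extended to a homeomorphism of $\overline{\mathbb{D}}$ onto the closure of that domain. For an arc $I\subset\mathbb{T}$ write $\gamma_I=f(I)\subset\Gamma$. (i) Let $0<p\le 1$. If $\Gamma$ is a $Q_{p,0}$-curve, i.e. $\log f'\in Q_{p,0}$, then for dyadic arcs $J\subset\mathbb{T}$, $$\frac{1}{|J|^p}\sum_{I\subset J}\beta^2(\gamma_I)\,|I|^p\to 0\quad\text{as } |J|\to 0,$$ where the sum is over all dyadic intervals $I$ in $\mathbb{T}$ such that $I\subset J$. (ii) Let $p\ge 0$. If $\Gamma$ is a $\mathcal{D}_{\log_p}$-curve, i.e. $\log f'\in\mathcal{D}_{\log_p}$, then $$\sum_{I}\beta^2(\gamma_I)\left(\log\frac{1}{|I|}\right)^p<\infty,$$ where the sum is over all dyadic intervals $I$ in $\mathbb{T}$.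
   Context: $\mathbb{D}$ is the open unit disc in $\mathbb{C}$, $\mathbb{T}=\partial\mathbb{D}$, and $dA$ is area (Lebesgue) measure. $\log f'$ denotes a holomorphic branch on $\mathbb{D}$ of the logarithm of $f'$. Dyadic intervals (arcs) of $\mathbb{T}$ are the arcs $\{e^{2\pi i\theta}: k2^{-n}\le\theta\le(k+1)2^{-n}\}$ with $n\ge1$ and $0\le k<2^n$; $|I|$ denotes the length of an arc, normalized so that $|\mathbb{T}|=1$. The limit as $|J|\to0$ is uniform over all dyadic arcs $J$ (the supremum over dyadic $J$ with $|J|\le\delta$ tends to $0$ as $\delta\to0$). For an arc $\gamma\subset\Gamma$ with distinct endpoints $w_1,w_2$, $$\beta(\gamma)=\frac{1}{|w_1-w_2|}\max\{\operatorname{dist}(w,L): w\in\gamma\},$$ where $L$ is the line passing through $w_1$ and $w_2$. For an arc $I\subset\mathbb{T}$, the Carleson box is $Q_I=\{z\in\mathbb{D}:1-|I|\le|z|<1,\ z/|z|\in I\}$. For $p>0$, an analytic function $g$ on $\mathbb{D}$ belongs to $Q_{p,0}$ if $$\lim_{|I|\to0}\frac{1}{|I|^p}\int_{Q_I}|g'(z)|^2(1-|z|^2)^p\,dA(z)=0,$$ the limit being uniform over all arcs $I\subset\mathbb{T}$. For $p\ge0$, an analytic function $g$ on $\mathbb{D}$ belongs to $\mathcal{D}_{\log_p}$ if $$\int_{\mathbb{D}}|g'(z)|^2\left(\log\frac{1}{1-|z|}\right)^p dA(z)<\infty .$$ When $p=0$, $p$-th powers of logarithms are understood to be identically $1$.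 *)

theory Defs
  imports "HOL-Complex_Analysis.Complex_Analysis"
begin

definition closed_jordan_curve :: "complex set \<Rightarrow> bool" where
  "closed_jordan_curve \<Gamma> \<longleftrightarrow>
     (\<exists>c. simple_path c \<and> pathfinish c = pathstart c \<and> path_image c = \<Gamma>)"

definition conformal_onto :: "(complex \<Rightarrow> complex) \<Rightarrow> complex set \<Rightarrow> complex set \<Rightarrow> bool" where
  "conformal_onto f U V \<longleftrightarrow> f holomorphic_on U \<and> inj_on f U \<and> f ` U = V"

definition log_deriv_branch :: "(complex \<Rightarrow> complex) \<Rightarrow> (complex \<Rightarrow> complex) \<Rightarrow> bool" where
  "log_deriv_branch f h \<longleftrightarrow>
     h holomorphic_on ball 0 1 \<and> (\<forall>z\<in>ball 0 1. exp (h z) = deriv f z)"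

text \<open>A closed arc of the unit circle is encoded by a pair \<open>(a, l)\<close>: it starts at the angle
  \<open>2 \<pi> a\<close>, runs counterclockwise, and has length \<open>l\<close>, normalized so that the
  whole circle has length \<open>1\<close>. Keeping a parametrization makes the endpoints of the arc, and
  of its image under a map, available; the underlying set is given by \<open>arc_set\<close>.\<close>

type_synonym circle_arc = "real \<times> real"

definition circle_arcs :: "circle_arc set" where
  "circle_arcs = {(a, l). 0 < l \<and> l \<le> 1}"

definition arc_length :: "circle_arc \<Rightarrow> real" where
  "arc_length I = snd I"

definition arc_path :: "circle_arc \<Rightarrow> real \<Rightarrow> complex" where
  "arc_path I = part_circlepath 0 1 (2 * pi * fst I) (2 * pi * (fst I + snd I))"

definition arc_set :: "circle_arc \<Rightarrow> complex set" where
  "arc_set I = path_image (arc_path I)"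

lemma arc_set_eq:
  assumes "0 \<le> l"
  shows "arc_set (a, l) = {cis (2 * pi * \<theta>) | \<theta>. a \<le> \<theta> \<and> \<theta> \<le> a + l}"
proof -
  have le: "2 * pi * a \<le> 2 * pi * (a + l)"
    using assms by simp
  have img: "{2 * pi * a..2 * pi * (a + l)} = (\<lambda>\<theta>. 2 * pi * \<theta>) ` {a..a + l}"
    using assms by (simp add: image_mult_atLeastAtMost)
  have "arc_set (a, l) = cis ` {2 * pi * a..2 * pi * (a + l)}"
    unfolding arc_set_def arc_path_def fst_conv snd_conv path_image_part_circlepath[OF le]
    by (auto simp: cis_conv_exp)
  then show ?thesis
    unfolding img image_image by auto
qed

text \<open>Since the starting points \<open>k / 2 ^ n\<close> lie in \<open>[0, 1)\<close>, each dyadic arc has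
  exactly one code in this set, so summing over codes is summing over arcs.\<close>

definition dyadic_arcs :: "circle_arc set" where
  "dyadic_arcs = {(real k / 2 ^ n, 1 / 2 ^ n) | n k. 1 \<le> n \<and> k < 2 ^ n}"

lemma dyadic_arcs_subset: "dyadic_arcs \<subseteq> circle_arcs"
  by (auto simp: dyadic_arcs_def circle_arcs_def)

text \<open>The supremum is attained when \<open>\<gamma>\<close> is continuous, its image being compact.\<close>

definition beta :: "(real \<Rightarrow> complex) \<Rightarrow> real" where
  "beta \<gamma> =
     1 / dist (pathstart \<gamma>) (pathfinish \<gamma>) *
     (SUP w\<in>path_image \<gamma>. infdist w (affine hull {pathstart \<gamma>, pathfinish \<gamma>}))"

definition carleson_box :: "circle_arc \<Rightarrow> complex set" where
  "carleson_box I =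
     {z. 1 - arc_length I \<le> norm z \<and> norm z < 1 \<and> z / of_real (norm z) \<in> arc_set I}"

definition Q_p0 :: "real \<Rightarrow> (complex \<Rightarrow> complex) set" where
  "Q_p0 p = {g. g holomorphic_on ball 0 1 \<and>
     ((\<lambda>\<delta>. SUP I\<in>{I \<in> circle_arcs. arc_length I \<le> \<delta>}.
         ennreal (1 / arc_length I powr p) *
         (\<integral>\<^sup>+z\<in>carleson_box I. ennreal ((norm (deriv g z))\<^sup>2 * (1 - (norm z)\<^sup>2) powr p) \<partial>lborel))
       \<longlongrightarrow> 0) (at_right 0)}"

text \<open>The \<open>p\<close>-th power of a nonnegative logarithm. The case \<open>p = 0\<close> is separate because
  \<open>0 powr 0 = 0\<close>.\<close>

definition log_power :: "real \<Rightarrow> real \<Rightarrow> real" where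
  "log_power p x = (if p = 0 then 1 else (ln x) powr p)"

definition D_log :: "real \<Rightarrow> (complex \<Rightarrow> complex) set" where
  "D_log p = {g. g holomorphic_on ball 0 1 \<and>
     (\<integral>\<^sup>+z\<in>ball 0 1. ennreal ((norm (deriv g z))\<^sup>2 * log_power p (1 / (1 - norm z))) \<partial>lborel) < \<infinity>}"

end

theory Submission
  imports Defs "HOL-Real_Asymp.Real_Asymp"
begin

text \<open>Let \<open>I\<close> be a short dyadic arc of length \<open>l\<close>, let \<open>c\<close> be a point at distance \<open>l\<close> from
  the circle below \<open>I\<close>, and let \<open>x \<in> I\<close>. Integrating \<open>f' = exp h\<close> from \<open>c\<close> to \<open>x\<close> along a
  segment and cutting it dyadically, the error of the approximation \<open>f c + f'(c) (x - c)\<close> to \<open>f x\<close>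
  is at most a constant times \<open>\<bar>f'(c)\<bar> l (\<Sum>j. q\<^sup>j m\<^sub>j)\<close>, where \<open>m\<^sub>j\<close> bounds the
  oscillation of \<open>h\<close> on the \<open>j\<close>-th piece and \<open>q\<close> is slightly larger than \<open>1 / 2\<close>, because
  the \<open>m\<^sub>j\<close> are uniformly small near the circle. By the mean value property, \<open>m\<^sub>j\<^sup>2\<close> is bounded by the
  integral of \<open>\<bar>h'\<bar>\<^sup>2\<close> over the part of the box above \<open>I\<close> at height about \<open>l / 2\<^sup>j\<close>. An
  arc of the circle deviates from its chord by \<open>O(l\<^sup>2)\<close>, so Cauchy-Schwarz gives
  \<open>\<beta>\<^sup>2 = O(l\<^sup>2 + \<Sum>j. 3\<^sup>-\<^sup>j \<integral>\<bar>h'\<bar>\<^sup>2)\<close>. Each point of the disc lies in boundedly many of the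
  regions belonging to a given scale and a given \<open>j\<close>, so the sum over all arcs with a weight
  that at most doubles from one scale to the next coarser one is controlled by the weighted integral
  of \<open>\<bar>h'\<bar>\<^sup>2\<close>.\<close>

subsection \<open>An area bound for holomorphic functions\<close>

lemma contour_integral_linepath_same_Im:
  assumes "Im z = c" "Im z' = c" "Re z = a" "Re z' = b" "a < b"
  shows "contour_integral (linepath z z') f = integral {a..b} (\<lambda>x. f (Complex x c))"
proof -
  define F where "F = (\<lambda>w. f (w + \<i> * of_real c))"
  have eq: "z = of_real a + \<i> * of_real c" "z' = of_real b + \<i> * of_real c"
    using assms by (auto simp: complex_eq_iff)
  have "contour_integral (linepath z z') f = contour_integral (linepath (of_real a) (of_real b)) F"
    by (simp add: contour_integral_integral linepath_def F_def eq scaleR_conv_of_real algebra_simps)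
  also have "\<dots> = integral {a..b} (\<lambda>x. F (of_real x))"
    using \<open>a < b\<close> by (subst contour_integral_linepath_Reals_eq) auto
  finally show ?thesis by (simp add: F_def Complex_eq)
qed

lemma square_in_ball:
  assumes "0 < r" "\<bar>Re z\<bar> \<le> r" "\<bar>Im z\<bar> \<le> r"
  shows "z \<in> ball 0 (2 * r)"
proof -
  have "(Re z)\<^sup>2 + (Im z)\<^sup>2 \<le> r\<^sup>2 + r\<^sup>2"
    using assms by (intro add_mono) (auto simp: abs_le_square_iff[symmetric])
  also have "\<dots> < (2 * r)\<^sup>2" using assms by (simp add: power2_eq_square)
  finally have "norm z < 2 * r"
    using assms by (simp add: cmod_def real_less_lsqrt)
  then show ?thesis by simp
qed

text \<open>Squares instead of circles, so that averaging over the side length is Tonelli in Cartesian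
  coordinates.\<close>

lemma Cauchy_square_bound:
  fixes g :: "complex \<Rightarrow> complex"
  assumes g: "g holomorphic_on ball 0 (2 * r)" and t: "0 < t" "t \<le> r"
  shows "2 * pi * t * norm (g 0) \<le>
     integral {-t..t} (\<lambda>y. norm (g (Complex t y))) + integral {-t..t} (\<lambda>y. norm (g (Complex (-t) y))) +
     (integral {-t..t} (\<lambda>x. norm (g (Complex x t))) + integral {-t..t} (\<lambda>x. norm (g (Complex x (-t)))))"
proof -
  let ?S = "{z::complex. \<bar>Re z\<bar> \<le> t \<and> \<bar>Im z\<bar> \<le> t}"
  have inS: "z \<in> ball 0 (2 * r)" if "z \<in> ?S" for z
    using that t by (intro square_in_ball) auto
  have gc: "continuous_on A g" if "A \<subseteq> ?S" for A
    using holomorphic_on_imp_continuous_on[OF g] by (rule continuous_on_subset) (use that inS in blast)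
  define q where "q = (\<lambda>w. g w / (w - 0))"
  have qc: "continuous_on A q" if "A \<subseteq> ?S - {0}" for A
    unfolding q_def using that by (intro continuous_intros gc) auto
  let ?a = "Complex (-t) (-t)" and ?b = "Complex t (-t)" and ?c = "Complex t t" and ?d = "Complex (-t) t"
  have rect: "path_image (rectpath ?a ?c) \<subseteq> ?S - {0}"
    using t by (subst path_image_rectpath) auto
  have "(q has_contour_integral (2*pi * \<i> * winding_number (rectpath ?a ?c) 0 * g 0)) (rectpath ?a ?c)"
    unfolding q_def
  proof (rule Cauchy_integral_formula_weak[of "ball 0 (2 * r)" "{}"])
    show "continuous_on (ball 0 (2 * r)) g" using holomorphic_on_imp_continuous_on[OF g] .
    show "g field_differentiable at x" if "x \<in> interior (ball 0 (2 * r)) - {}" for x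
      using g that by (auto simp: holomorphic_on_imp_differentiable_at)
    show "path_image (rectpath ?a ?c) \<subseteq> ball 0 (2 * r) - {0}" using rect inS by blast
  qed (use t in auto)
  moreover have "winding_number (rectpath ?a ?c) 0 = 1"
    using t by (intro winding_number_rectpath) (auto simp: in_box_complex_iff)
  ultimately have I: "contour_integral (rectpath ?a ?c) q = 2 * pi * \<i> * g 0"
    by (simp add: contour_integral_unique)
  have segs: "closed_segment ?a ?b \<subseteq> ?S - {0}" "closed_segment ?b ?c \<subseteq> ?S - {0}"
     "closed_segment ?c ?d \<subseteq> ?S - {0}" "closed_segment ?d ?a \<subseteq> ?S - {0}"
    using rect t by (auto simp: rectpath_def Let_def path_image_join)
  have segs': "closed_segment ?d ?c \<subseteq> ?S - {0}" "closed_segment ?a ?d \<subseteq> ?S - {0}"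
    using segs by (simp_all add: closed_segment_commute)
  note ci = contour_integrable_continuous_linepath[OF qc]
  have sum: "contour_integral (rectpath ?a ?c) q =
     contour_integral (linepath ?a ?b) q + (contour_integral (linepath ?b ?c) q
      + (contour_integral (linepath ?c ?d) q + contour_integral (linepath ?d ?a) q))"
    unfolding rectpath_def Let_def using segs
    by (simp add: ci contour_integrable_join)
  \<comment> \<open>Every boundary point of the square has modulus at least \<open>t\<close>, so the
    Cauchy kernel costs at most a factor \<open>1 / t\<close>.\<close>
  have bnd: "norm (integral {-t..t} (\<lambda>y. q (\<phi> y))) \<le> integral {-t..t} (\<lambda>y. norm (g (\<phi> y))) / t"
    if "continuous_on UNIV \<phi>" and \<phi>: "\<And>y. y \<in> {-t..t} \<Longrightarrow> \<phi> y \<in> ?S \<and> t \<le> norm (\<phi> y)" for \<phi>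
  proof -
    have c\<phi>: "continuous_on {-t..t} \<phi>" using that(1) continuous_on_subset by blast
    have 0: "continuous_on {-t..t} (\<lambda>y. g (\<phi> y))"
      by (rule continuous_on_compose2[OF gc[OF subset_refl] c\<phi>]) (use \<phi> in auto)
    have "norm (integral {-t..t} (\<lambda>y. q (\<phi> y))) \<le> integral {-t..t} (\<lambda>y. norm (g (\<phi> y)) / t)"
    proof (rule integral_norm_bound_integral)
      show "(\<lambda>y. q (\<phi> y)) integrable_on {-t..t}"
        by (intro integrable_continuous_interval continuous_on_compose2[OF qc[OF subset_refl] c\<phi>])
           (use \<phi> t in force)
      show "(\<lambda>y. norm (g (\<phi> y)) / t) integrable_on {-t..t}"
        by (intro integrable_continuous_interval continuous_intros 0) (use t in auto)
      show "norm (q (\<phi> y)) \<le> norm (g (\<phi> y)) / t" if "y \<in> {-t..t}" for y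
        using \<phi>[OF that] t by (auto simp: q_def norm_divide intro!: divide_left_mono mult_pos_pos)
    qed
    then show ?thesis by simp
  qed
  have 1: "norm (contour_integral (linepath ?a ?b) q) \<le> integral {-t..t} (\<lambda>y. norm (g (Complex y (-t)))) / t"
    using t abs_Im_le_cmod[of "Complex _ (-t)"]
    by (subst contour_integral_linepath_same_Im[where a="-t" and b="t" and c = "-t"])
       (auto intro!: bnd simp: continuous_on_Complex)
  have 2: "norm (contour_integral (linepath ?b ?c) q) \<le> integral {-t..t} (\<lambda>y. norm (g (Complex t y))) / t"
    using t abs_Re_le_cmod[of "Complex t _"]
    by (subst contour_integral_linepath_same_Re[where a="-t" and b="t" and c = "t"])
       (auto intro!: bnd simp: norm_mult continuous_on_Complex)
  have 3: "norm (contour_integral (linepath ?c ?d) q) \<le> integral {-t..t} (\<lambda>y. norm (g (Complex y t))) / t"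
    using t abs_Im_le_cmod[of "Complex _ t"]
    by (subst contour_integral_reverse_linepath[OF qc[OF segs(3)]],
       subst contour_integral_linepath_same_Im[where a="-t" and b="t" and c = "t"])
       (auto intro!: bnd simp: continuous_on_Complex)
  have 4: "norm (contour_integral (linepath ?d ?a) q) \<le> integral {-t..t} (\<lambda>y. norm (g (Complex (-t) y))) / t"
    using t abs_Re_le_cmod[of "Complex (-t) _"]
    by (subst contour_integral_reverse_linepath[OF qc[OF segs(4)]],
       subst contour_integral_linepath_same_Re[where a="-t" and b="t" and c = "-t"])
       (auto intro!: bnd simp: norm_mult continuous_on_Complex)
  have "2 * pi * norm (g 0) = norm (contour_integral (rectpath ?a ?c) q)"
    unfolding I by (simp add: norm_mult)
  also have "\<dots> \<le> norm (contour_integral (linepath ?a ?b) q) + norm (contour_integral (linepath ?b ?c) q)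
      + norm (contour_integral (linepath ?c ?d) q) + norm (contour_integral (linepath ?d ?a) q)"
    unfolding sum by norm
  also note add_mono[OF add_mono[OF add_mono[OF 1 2] 3] 4]
  finally have "2 * pi * norm (g 0) \<le> (integral {-t..t} (\<lambda>y. norm (g (Complex y (-t))))
    + integral {-t..t} (\<lambda>y. norm (g (Complex t y)))
    + integral {-t..t} (\<lambda>y. norm (g (Complex y t)))
    + integral {-t..t} (\<lambda>y. norm (g (Complex (-t) y)))) / t"
    by (simp add: add_divide_distrib)
  then show ?thesis using t by (simp add: pos_le_divide_eq mult_ac add_ac)
qed

section \<open>Lebesgue measure on the plane as a product measure\<close>

lemma measurable_Complex [measurable]:
  assumes [measurable]: "u \<in> borel_measurable M" "v \<in> borel_measurable M"
  shows "(\<lambda>x. Complex (u x) (v x)) \<in> borel_measurable M"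
  unfolding Complex_eq by measurable

lemma lborel_complex_eq_distr:
  "(lborel :: complex measure) = distr (lborel \<Otimes>\<^sub>M lborel) borel (\<lambda>(x, y). Complex x y)"
proof (rule lborel_eqI)
  fix l u :: complex
  assume le: "\<And>b. b \<in> Basis \<Longrightarrow> l \<bullet> b \<le> u \<bullet> b"
  have le: "Re l \<le> Re u" "Im l \<le> Im u" using le[of 1] le[of \<i>] by (auto simp: Basis_complex_def)
  have eq: "(\<lambda>z. Complex (fst z) (snd z)) -` box l u \<inter> space (lborel \<Otimes>\<^sub>M lborel) =
      {Re l<..<Re u} \<times> {Im l<..<Im u}"
    by (auto simp: in_box_complex_iff space_pair_measure)
  have "emeasure (distr (lborel \<Otimes>\<^sub>M lborel) borel (\<lambda>(x, y). Complex x y)) (box l u) =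
     emeasure (lborel \<Otimes>\<^sub>M lborel) ({Re l<..<Re u} \<times> {Im l<..<Im u})"
    by (subst emeasure_distr) (simp_all add: eq split_beta')
  also have "\<dots> = ennreal (Re u - Re l) * ennreal (Im u - Im l)"
    using le by (subst lborel.emeasure_pair_measure_Times) auto
  also have "\<dots> = ennreal (\<Prod>b\<in>Basis. (u - l) \<bullet> b)"
    using le by (simp add: Basis_complex_def ennreal_mult)
  finally show "emeasure (distr (lborel \<Otimes>\<^sub>M lborel) borel (\<lambda>(x, y). Complex x y)) (box l u) =
      ennreal (\<Prod>b\<in>Basis. (u - l) \<bullet> b)" .
qed simp

lemma nn_integral_complex_Re_Im:
  fixes F :: "complex \<Rightarrow> ennreal"
  assumes [measurable]: "F \<in> borel_measurable borel"
  shows "(\<integral>\<^sup>+x. \<integral>\<^sup>+y. F (Complex x y) \<partial>lborel \<partial>lborel) = (\<integral>\<^sup>+z. F z \<partial>lborel)"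
    and "(\<integral>\<^sup>+y. \<integral>\<^sup>+x. F (Complex x y) \<partial>lborel \<partial>lborel) = (\<integral>\<^sup>+z. F z \<partial>lborel)"
proof -
  have "(\<integral>\<^sup>+z. F z \<partial>lborel) = (\<integral>\<^sup>+z. F (case z of (x, y) \<Rightarrow> Complex x y) \<partial>(lborel \<Otimes>\<^sub>M lborel))"
    by (subst lborel_complex_eq_distr, subst nn_integral_distr) auto
  also have "\<dots> = (\<integral>\<^sup>+z. F (Complex (fst z) (snd z)) \<partial>(lborel \<Otimes>\<^sub>M lborel))"
    by (simp add: case_prod_beta)
  finally have *: "(\<integral>\<^sup>+z. F z \<partial>lborel) = \<dots>" .
  show "(\<integral>\<^sup>+x. \<integral>\<^sup>+y. F (Complex x y) \<partial>lborel \<partial>lborel) = (\<integral>\<^sup>+z. F z \<partial>lborel)"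
    unfolding * by (subst lborel.nn_integral_fst[symmetric]) auto
  show "(\<integral>\<^sup>+y. \<integral>\<^sup>+x. F (Complex x y) \<partial>lborel \<partial>lborel) = (\<integral>\<^sup>+z. F z \<partial>lborel)"
    unfolding * by (subst lborel_pair.nn_integral_snd[symmetric]) (auto simp: case_prod_beta)
qed

text \<open>\<open>Cauchy_square_bound\<close> is integrated over t in [r/2, r]. Each of the four
  families of parallel sides sweeps out part of the disc once, so by Tonelli it contributes at most
  the area integral \<open>I\<close>. This gives (pi r^2 / 2) |g(0)| \<le> 4 I, and 8 / pi <
  3.\<close>

lemma holomorphic_area_bound_0:
  fixes g :: "complex \<Rightarrow> complex"
  assumes g: "g holomorphic_on ball 0 (2 * r)" and r: "0 < r"
  shows "ennreal (r\<^sup>2 * norm (g 0)) \<le> 3 * (\<integral>\<^sup>+z\<in>ball 0 (2 * r). ennreal (norm (g z)) \<partial>lborel)"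
proof -
  \<comment> \<open>Extension by zero gives a Borel function on the whole plane; nothing is known
    about \<open>g\<close> outside the disc.\<close>
  define \<Phi> where "\<Phi> z = ennreal (norm (indicator (ball 0 (2 * r)) z *\<^sub>R g z))" for z
  have [measurable]: "\<Phi> \<in> borel_measurable borel"
  proof -
    have [measurable]: "(\<lambda>z. indicator (ball 0 (2 * r)) z *\<^sub>R g z) \<in> borel_measurable borel"
      using holomorphic_on_imp_continuous_on[OF g] by (intro borel_measurable_continuous_on_indicator) auto
    show ?thesis unfolding \<Phi>_def by measurable
  qed
  define I where "I = (\<integral>\<^sup>+z. \<Phi> z \<partial>lborel)"
  have I: "I = (\<integral>\<^sup>+z\<in>ball 0 (2 * r). ennreal (norm (g z)) \<partial>lborel)"
    unfolding I_def \<Phi>_def by (intro nn_integral_cong) (auto simp: indicator_def)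
  have side: "ennreal (integral {-t..t} (\<lambda>y. norm (g (\<phi> y)))) \<le> (\<integral>\<^sup>+y. \<Phi> (\<phi> y) \<partial>lborel)"
    if t: "t \<in> {r/2..r}" and c\<phi>: "continuous_on UNIV \<phi>"
      and \<phi>: "\<And>y. y \<in> {-t..t} \<Longrightarrow> \<bar>Re (\<phi> y)\<bar> \<le> r \<and> \<bar>Im (\<phi> y)\<bar> \<le> r" for t \<phi>
  proof -
    have in_ball: "\<phi> y \<in> ball 0 (2 * r)" if y: "y \<in> {-t..t}" for y
      using \<phi>[OF y] r by (intro square_in_ball) auto
    have "continuous_on {-t..t} (\<lambda>y. g (\<phi> y))"
      by (rule continuous_on_compose2[OF holomorphic_on_imp_continuous_on[OF g]])
         (use in_ball continuous_on_subset[OF c\<phi>] in auto)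
    then have "((\<lambda>y. norm (g (\<phi> y))) has_integral integral {-t..t} (\<lambda>y. norm (g (\<phi> y)))) {-t..t}"
      by (intro integrable_integral integrable_continuous_interval continuous_on_norm)
    then have "(\<integral>\<^sup>+y. ennreal (norm (g (\<phi> y))) * indicator {-t..t} y \<partial>lborel)
        = ennreal (integral {-t..t} (\<lambda>y. norm (g (\<phi> y))))"
      by (intro nn_integral_has_integral_lebesgue') auto
    moreover have "(\<integral>\<^sup>+y. ennreal (norm (g (\<phi> y))) * indicator {-t..t} y \<partial>lborel) \<le> (\<integral>\<^sup>+y. \<Phi> (\<phi> y) \<partial>lborel)"
      using in_ball by (intro nn_integral_mono) (auto simp: indicator_def \<Phi>_def)
    ultimately show ?thesis by simp
  qed
  have nn: "0 \<le> integral {-t..t} (\<lambda>y. norm (g (\<phi> y)))" for t and \<phi> :: "real \<Rightarrow> complex"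
    by (cases "(\<lambda>y. norm (g (\<phi> y))) integrable_on {-t..t}")
       (auto intro: integral_nonneg simp: not_integrable_integral)
  have pt: "ennreal (pi * r * norm (g 0)) * indicator {r/2..r} t \<le>
      ((\<integral>\<^sup>+y. \<Phi> (Complex t y) \<partial>lborel) + (\<integral>\<^sup>+y. \<Phi> (Complex (-t) y) \<partial>lborel)) +
      ((\<integral>\<^sup>+x. \<Phi> (Complex x t) \<partial>lborel) + (\<integral>\<^sup>+x. \<Phi> (Complex x (-t)) \<partial>lborel))" for t
  proof (cases "t \<in> {r/2..r}")
    case True
    have "pi * r * norm (g 0) \<le> 2 * pi * t * norm (g 0)"
      using True by (intro mult_right_mono) auto
    also note Cauchy_square_bound[OF g]
    finally have "ennreal (pi * r * norm (g 0)) \<le> ennreal (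
     (integral {-t..t} (\<lambda>y. norm (g (Complex t y))) + integral {-t..t} (\<lambda>y. norm (g (Complex (-t) y)))) +
     (integral {-t..t} (\<lambda>x. norm (g (Complex x t))) + integral {-t..t} (\<lambda>x. norm (g (Complex x (-t))))))"
      using True r by (intro ennreal_leI) auto
    also have "\<dots> = 
     (ennreal (integral {-t..t} (\<lambda>y. norm (g (Complex t y)))) + ennreal (integral {-t..t} (\<lambda>y. norm (g (Complex (-t) y))))) +
     (ennreal (integral {-t..t} (\<lambda>x. norm (g (Complex x t)))) + ennreal (integral {-t..t} (\<lambda>x. norm (g (Complex x (-t))))))"
      using nn by simp
    also have "\<dots> \<le> ((\<integral>\<^sup>+y. \<Phi> (Complex t y) \<partial>lborel) + (\<integral>\<^sup>+y. \<Phi> (Complex (-t) y) \<partial>lborel)) +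
      ((\<integral>\<^sup>+x. \<Phi> (Complex x t) \<partial>lborel) + (\<integral>\<^sup>+x. \<Phi> (Complex x (-t)) \<partial>lborel))"
      using True r by (intro add_mono side) (auto simp: continuous_on_Complex)
    finally show ?thesis using True by simp
  qed simp
  \<comment> \<open>The sides at \<open>-t\<close> are reduced to those at \<open>t\<close> by
    reflection.\<close>
  have refl_: "(\<integral>\<^sup>+t. F (- t) \<partial>lborel) = (\<integral>\<^sup>+t. F t \<partial>lborel)" if "F \<in> borel_measurable borel" for F :: "real \<Rightarrow> ennreal"
    using nn_integral_real_affine[OF that, of "-1" 0] by simp
  have m1 [measurable]: "(\<lambda>x. \<integral>\<^sup>+y. \<Phi> (Complex x y) \<partial>lborel) \<in> borel_measurable borel"
    by measurable
  have m2 [measurable]: "(\<lambda>y. \<integral>\<^sup>+x. \<Phi> (Complex x y) \<partial>lborel) \<in> borel_measurable borel"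
    by measurable
  have "ennreal (pi * r * norm (g 0)) * ennreal (r / 2) = (\<integral>\<^sup>+t. ennreal (pi * r * norm (g 0)) * indicator {r/2..r} t \<partial>lborel)"
    using r by (simp add: nn_integral_cmult_indicator)
  also have "\<dots> \<le> (\<integral>\<^sup>+t. ((\<integral>\<^sup>+y. \<Phi> (Complex t y) \<partial>lborel) + (\<integral>\<^sup>+y. \<Phi> (Complex (-t) y) \<partial>lborel)) +
      ((\<integral>\<^sup>+x. \<Phi> (Complex x t) \<partial>lborel) + (\<integral>\<^sup>+x. \<Phi> (Complex x (-t)) \<partial>lborel)) \<partial>lborel)"
    by (intro nn_integral_mono pt)
  also have "\<dots> = (I + I) + (I + I)"
    by (simp add: nn_integral_add refl_[OF m1] refl_[OF m2] nn_integral_complex_Re_Im I_def)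
  finally have *: "ennreal (pi * r * norm (g 0)) * ennreal (r / 2) \<le> (I + I) + (I + I)" .
  show ?thesis
  proof (cases I)
    case (real i)
    have "ennreal (pi * r * norm (g 0) * (r / 2)) \<le> ennreal (4 * i)"
    proof -
      have "(I + I) + (I + I) = ennreal ((i + i) + (i + i))"
        using real by (simp only: ennreal_plus add_nonneg_nonneg)
      moreover have "ennreal (pi * r * norm (g 0)) * ennreal (r / 2) = ennreal (pi * r * norm (g 0) * (r / 2))"
        using r by (intro ennreal_mult[symmetric]) auto
      ultimately show ?thesis using * by simp
    qed
    then have "pi * (r\<^sup>2 * norm (g 0)) \<le> 8 * i"
      using real by (simp add: power2_eq_square mult_ac)
    moreover have "3 * (r\<^sup>2 * norm (g 0)) \<le> pi * (r\<^sup>2 * norm (g 0))"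
      using pi_gt3 by (intro mult_right_mono) auto
    ultimately have "r\<^sup>2 * norm (g 0) \<le> 3 * i" using real by linarith
    then show ?thesis unfolding I[symmetric] using real
      by (simp add: ennreal_mult'[symmetric] flip: ennreal_numeral)
  qed (simp add: I[symmetric])
qed

lemma holomorphic_area_bound:
  fixes g :: "complex \<Rightarrow> complex"
  assumes g: "g holomorphic_on ball c (2 * r)" and r: "0 < r"
  shows "ennreal (r\<^sup>2 * norm (g c)) \<le> 3 * (\<integral>\<^sup>+z\<in>ball c (2 * r). ennreal (norm (g z)) \<partial>lborel)"
proof -
  have "(\<lambda>z. g (c + z)) holomorphic_on ball 0 (2 * r)"
    by (rule holomorphic_on_compose_gen[OF _ g, unfolded o_def]) (auto intro!: holomorphic_intros simp: dist_norm)
  from holomorphic_area_bound_0[OF this r]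
  have "ennreal (r\<^sup>2 * norm (g c)) \<le> 3 * (\<integral>\<^sup>+z. ennreal (norm (g (c + z))) * indicator (ball 0 (2 * r)) z \<partial>lborel)"
    by simp
  also have "(\<integral>\<^sup>+z. ennreal (norm (g (c + z))) * indicator (ball 0 (2 * r)) z \<partial>lborel)
     = (\<integral>\<^sup>+z. ennreal (norm (indicator (ball c (2 * r)) (c + z) *\<^sub>R g (c + z))) \<partial>lborel)"
    by (intro nn_integral_cong) (auto simp: indicator_def dist_norm)
  also have "\<dots> = (\<integral>\<^sup>+z. ennreal (norm (indicator (ball c (2 * r)) z *\<^sub>R g z)) \<partial>lborel)"
  proof -
    have [measurable]: "(\<lambda>z. indicator (ball c (2 * r)) z *\<^sub>R g z) \<in> borel_measurable borel"
      using holomorphic_on_imp_continuous_on[OF g] by (intro borel_measurable_continuous_on_indicator) auto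
    show ?thesis
      by (subst (2) lborel_distr_plus[of c, symmetric], subst nn_integral_distr) (simp_all del: norm_scaleR)
  qed
  also have "\<dots> = (\<integral>\<^sup>+z\<in>ball c (2 * r). ennreal (norm (g z)) \<partial>lborel)"
    by (intro nn_integral_cong) (auto simp: indicator_def)
  finally show ?thesis .
qed

subsection \<open>Linear approximation at a boundary point\<close>

lemma norm_exp_minus_one_le: "norm (exp u - 1) \<le> norm u * exp (norm u)" for u :: complex
  using Taylor_exp_field[of u 0] by (simp add: mult.commute)

text \<open>Interchanging the sums gives \<open>m j\<close> the coefficient q^j + ... + q^(K-1), a
  truncated geometric tail. The term with \<open>q ^ K / (1 - q)\<close> completes all tails to q^j
  / (1 - q).\<close>

lemma sum_geometric_tails:
  fixes q :: real
  assumes "q \<noteq> 1"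
  shows "(\<Sum>k<K. q ^ k * (\<Sum>j<Suc k. m j)) + q ^ K / (1 - q) * (\<Sum>j<K. m j)
     = (\<Sum>j<K. q ^ j * m j) / (1 - q)"
proof (induction K)
  case (Suc K)
  have "q ^ K * X + q ^ Suc K / (1 - q) * X = q ^ K / (1 - q) * X" for X
    using assms by (simp add: divide_simps) (simp add: algebra_simps)
  from this[of "\<Sum>j<Suc K. m j"]
  have "(\<Sum>k<Suc K. q ^ k * (\<Sum>j<Suc k. m j)) + q ^ Suc K / (1 - q) * (\<Sum>j<Suc K. m j)
    = (\<Sum>k<K. q ^ k * (\<Sum>j<Suc k. m j)) + q ^ K / (1 - q) * (\<Sum>j<Suc K. m j)"
    by simp
  also have "\<dots> = (\<Sum>k<K. q ^ k * (\<Sum>j<Suc k. m j)) + q ^ K / (1 - q) * (\<Sum>j<K. m j) + q ^ K * m K / (1 - q)"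
    by (simp add: distrib_left del: sum.lessThan_Suc) (simp add: algebra_simps add_divide_distrib)
  also have "\<dots> = (\<Sum>j<K. q ^ j * m j) / (1 - q) + q ^ K * m K / (1 - q)"
    unfolding Suc.IH ..
  also have "\<dots> = (\<Sum>j<Suc K. q ^ j * m j) / (1 - q)"
    by (simp add: add_divide_distrib)
  finally show ?case .
qed simp

lemma convex_line_image: "convex ((\<lambda>t. x + t *\<^sub>R v) ` {a..b})" for x v :: "'a :: real_normed_vector"
proof -
  have "(\<lambda>t. x + t *\<^sub>R v) ` {a..b} = (\<lambda>y. x + y) ` (\<lambda>t. t *\<^sub>R v) ` {a..b}"
    by (simp add: image_image)
  then show ?thesis
    by (simp only:) (intro convex_translation convex_linear_image bounded_linear.linear[OF bounded_linear_scaleR_left] convex_real_interval)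
qed

text \<open>The increments of f(z) - f'(c) z are telescoped along the points at parameters 1/2^k. On
  the k-th piece h differs from h(c) by at most M = m_0 + ... + m_k, so the derivative is at most
  |f'(c)| M e^M. Here e^M \<le> (10/9)^(k+1), and the piece has length at most 8 s / 2^(k+1); the
  halving of the pieces therefore beats the growth of e^M and leaves the ratio 5/9.\<close>

lemma radial_linear_approx:
  fixes f h :: "complex \<Rightarrow> complex"
  assumes f: "f holomorphic_on ball 0 1" and h: "\<And>z. z \<in> ball 0 1 \<Longrightarrow> exp (h z) = deriv f z"
    and x: "norm x = 1" and c: "norm c < 1" and xc: "norm (c - x) \<le> 8 * s"
    and m: "\<And>j. 0 \<le> m j" "\<And>j. m j \<le> 1 / 100"
    and osc: "\<And>j t. 1 / 2 ^ Suc j \<le> t \<Longrightarrow> t \<le> 1 / 2 ^ j \<Longrightarrow> norm (h (x + t *\<^sub>R (c - x)) - h c) \<le> (\<Sum>i<Suc j. m i)"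
  shows "norm (f (x + (1 / 2 ^ K) *\<^sub>R (c - x)) - f c - deriv f c * (x + (1 / 2 ^ K) *\<^sub>R (c - x) - c))
     \<le> norm (deriv f c) * (10 * s * (\<Sum>j<K. (5/9) ^ j * m j))"
proof -
  define w where "w t = x + t *\<^sub>R (c - x)" for t :: real
  define \<phi> where "\<phi> z = f z - deriv f c * z" for z
  have s: "0 \<le> s" using xc norm_ge_zero[of "c - x"] by linarith
  have w_in: "w t \<in> ball 0 1" if "0 < t" "t \<le> 1" for t
  proof -
    have "w t = (1 - t) *\<^sub>R x + t *\<^sub>R c" by (simp add: w_def algebra_simps)
    then have "norm (w t) \<le> (1 - t) * norm x + t * norm c"
      using that norm_triangle_ineq[of "(1 - t) *\<^sub>R x" "t *\<^sub>R c"] by simp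
    also have "\<dots> < (1 - t) * norm x + t * 1" using that c by (intro add_strict_left_mono mult_strict_left_mono) auto
    finally show ?thesis using x by simp
  qed
  \<comment> \<open>Half of this bound is the ratio 5/9. Its square has to stay below 1/3 in the
    later Cauchy-Schwarz step, so any bound below 2 / sqrt 3 would serve.\<close>
  have exp100: "exp (1/100 :: real) \<le> 10 / 9"
    using exp_bound[of "1/100"] by (simp add: power2_eq_square)
  have step: "norm (\<phi> (w (1 / 2 ^ Suc k)) - \<phi> (w (1 / 2 ^ k)))
      \<le> norm (deriv f c) * (40 / 9 * s * ((5/9) ^ k * (\<Sum>i<Suc k. m i)))" for k
  proof -
    define M where "M = (\<Sum>i<Suc k. m i)"
    have M: "0 \<le> M" unfolding M_def by (intro sum_nonneg m)
    have "M \<le> (\<Sum>i<Suc k. 1 / 100)" unfolding M_def by (intro sum_mono m)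
    then have "M \<le> real (Suc k) * (1 / 100)" by simp
    then have "exp M \<le> exp (real (Suc k) * (1 / 100))" by simp
    also have "\<dots> = exp (1/100) ^ Suc k" by (rule exp_of_nat_mult)
    also have "\<dots> \<le> (10 / 9) ^ Suc k" using exp100 by (intro power_mono) auto
    finally have eM: "exp M \<le> (10 / 9) ^ Suc k" .
    define S where "S = w ` {1 / 2 ^ Suc k..1 / 2 ^ k}"
    have S: "convex S" unfolding S_def w_def by (rule convex_line_image)
    have "norm (\<phi> (w (1 / 2 ^ Suc k)) - \<phi> (w (1 / 2 ^ k)))
        \<le> (norm (deriv f c) * (M * exp M)) * norm (w (1 / 2 ^ Suc k) - w (1 / 2 ^ k))"
    proof (rule field_differentiable_bound[OF S])
      fix z assume "z \<in> S"
      then obtain t where t: "1 / 2 ^ Suc k \<le> t" "t \<le> 1 / 2 ^ k" "z = w t" by (auto simp: S_def)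
      have "0 < t" using t(1) by (rule less_le_trans[rotated]) simp
      moreover have "t \<le> 1" using t(2) by (rule order_trans) simp
      ultimately have z: "z \<in> ball 0 1" using w_in t by simp
      show "(\<phi> has_field_derivative (deriv f z - deriv f c)) (at z within S)"
        unfolding \<phi>_def using holomorphic_derivI[OF f open_ball z, of S]
        by (auto intro!: derivative_eq_intros)
      have o: "norm (h z - h c) \<le> M" unfolding M_def t(3) w_def by (rule osc[OF t(1,2)])
      have "deriv f z - deriv f c = deriv f c * (exp (h z - h c) - 1)"
        using h[OF z] h[of c] c by (simp add: exp_diff algebra_simps) (simp flip: h)
      then have "norm (deriv f z - deriv f c) = norm (deriv f c) * norm (exp (h z - h c) - 1)"
        by (simp add: norm_mult)
      also have "\<dots> \<le> norm (deriv f c) * (norm (h z - h c) * exp (norm (h z - h c)))"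
        by (intro mult_left_mono norm_exp_minus_one_le) auto
      also have "\<dots> \<le> norm (deriv f c) * (M * exp M)"
        using o M by (intro mult_left_mono mult_mono) auto
      finally show "norm (deriv f z - deriv f c) \<le> norm (deriv f c) * (M * exp M)" .
    qed (auto simp: S_def intro!: imageI divide_left_mono)
    also have "w (1 / 2 ^ Suc k) - w (1 / 2 ^ k) = (- (1 / 2 ^ Suc k)) *\<^sub>R (c - x)"
      by (simp add: w_def algebra_simps flip: scaleR_add_left scaleR_diff_left)
    also have "norm \<dots> \<le> (1 / 2 ^ Suc k) * (8 * s)"
      using mult_left_mono[OF xc, of "1 / 2 ^ Suc k"] by simp
    also have "norm (deriv f c) * (M * exp M) * (1 / 2 ^ Suc k * (8 * s))
        \<le> norm (deriv f c) * (M * (10 / 9) ^ Suc k) * (1 / 2 ^ Suc k * (8 * s))"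
      using M s eM by (intro mult_right_mono mult_left_mono) auto
    also have "\<dots> = norm (deriv f c) * (40 / 9 * s * ((5/9) ^ k * M))"
      by (simp add: power_divide field_simps flip: power_mult_distrib)
    finally show ?thesis using M s unfolding M_def by (simp add: mult_left_mono)
  qed
  have tel: "norm (\<phi> (w (1 / 2 ^ K)) - \<phi> (w 1)) \<le> (\<Sum>k<K. norm (deriv f c) * (40 / 9 * s * ((5/9) ^ k * (\<Sum>i<Suc k. m i))))"
  proof (induction K)
    case (Suc K)
    have "norm (\<phi> (w (1 / 2 ^ Suc K)) - \<phi> (w 1)) \<le> norm (\<phi> (w (1 / 2 ^ Suc K)) - \<phi> (w (1 / 2 ^ K))) + norm (\<phi> (w (1 / 2 ^ K)) - \<phi> (w 1))"
      by norm
    with step[of K] Suc show ?case by simp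
  qed simp
  \<comment> \<open>Adding the nonnegative completion term produces full geometric tails; their
    factor 9/4 turns 40/9 into 10.\<close>
  have "(\<Sum>k<K. (5/9) ^ k * (\<Sum>i<Suc k. m i)) \<le> (\<Sum>k<K. (5/9) ^ k * (\<Sum>i<Suc k. m i)) + (5/9) ^ K / (1 - 5/9) * (\<Sum>j<K. m j)"
    using m(1) by (simp add: sum_nonneg)
  also have "\<dots> = (\<Sum>j<K. (5/9) ^ j * m j) / (1 - 5/9)"
    by (rule sum_geometric_tails) simp
  finally have "norm (deriv f c) * (40 / 9 * s * (\<Sum>k<K. (5/9) ^ k * (\<Sum>i<Suc k. m i)))
      \<le> norm (deriv f c) * (40 / 9 * s * ((\<Sum>j<K. (5/9) ^ j * m j) / (1 - 5/9)))"
    using s by (intro mult_left_mono) auto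
  also have "\<dots> = norm (deriv f c) * (10 * s * (\<Sum>j<K. (5/9) ^ j * m j))" by simp
  finally have "norm (\<phi> (w (1 / 2 ^ K)) - \<phi> (w 1)) \<le> norm (deriv f c) * (10 * s * (\<Sum>j<K. (5/9) ^ j * m j))"
    using tel by (simp add: sum_distrib_left mult.assoc)
  moreover have "\<phi> (w (1 / 2 ^ K)) - \<phi> (w 1) = f (w (1 / 2 ^ K)) - f c - deriv f c * (w (1 / 2 ^ K) - c)"
    by (simp add: \<phi>_def w_def algebra_simps)
  ultimately show ?thesis by (simp add: w_def)
qed

text \<open>This is the Dirichlet integral. Values in \<open>ennreal\<close> allow it to be used
  before finiteness is known.\<close>

definition energy :: "(complex \<Rightarrow> complex) \<Rightarrow> complex set \<Rightarrow> ennreal" where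
  "energy h A = (\<integral>\<^sup>+z\<in>A. ennreal ((norm (deriv h z))\<^sup>2) \<partial>lborel)"

text \<open>The set \<open>boundary_box x r\<close> contains the discs of radius \<open>r / 4\<close> about the points at
  distance comparable to \<open>r\<close> from \<open>x\<close> on a nontangential segment ending at \<open>x\<close>.\<close>

definition boundary_box :: "complex \<Rightarrow> real \<Rightarrow> complex set" where
  "boundary_box x r = {z. r / 4 \<le> 1 - norm z \<and> dist x z \<le> 9 * r}"

lemma energy_mono: "A \<subseteq> B \<Longrightarrow> energy h A \<le> energy h B"
  unfolding energy_def by (intro nn_integral_mono) (auto simp: indicator_def)

text \<open>The area bound is applied to the square of h' on the disc of radius \<rho>/4 about the
  point of the segment, with \<rho> = s / 2^j. This disc stays inside
  \<open>boundary_box x \<rho>\<close>. Removing the factor (1/8)^2 gives 64 * 3 = 192.\<close>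

lemma deriv_bound_energy:
  fixes j :: nat
  assumes h: "h holomorphic_on ball 0 1" and x: "norm x = 1" and c: "norm c = 1 - s"
    and s: "0 < s" "s \<le> 1" and xc: "norm (c - x) \<le> 8 * s"
    and t: "1 / 2 ^ Suc j \<le> t" "t \<le> 1 / 2 ^ j"
  shows "x + t *\<^sub>R (c - x) \<in> ball 0 1"
    and "ennreal ((norm (deriv h (x + t *\<^sub>R (c - x))) * (s / 2 ^ j))\<^sup>2) \<le> 192 * energy h (boundary_box x (s / 2 ^ j))"
proof -
  define \<rho> where "\<rho> = s / 2 ^ j"
  have \<rho>: "0 < \<rho>" using s by (simp add: \<rho>_def)
  define w where "w = x + t *\<^sub>R (c - x)"
  have t0: "0 < t" using t(1) by (rule less_le_trans[rotated]) simp
  have t1: "t \<le> 1" using t(2) by (rule order_trans) simp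
  \<comment> \<open>By convexity of the norm, the point at parameter \<open>t\<close> has distance
    at least \<open>t * s\<close> from the circle; thus the height is at least \<rho>/2 on the whole
    piece.\<close>
  have ts: "\<rho> / 2 \<le> t * s" "t * s \<le> \<rho>"
    using mult_right_mono[OF t(1), of s] mult_right_mono[OF t(2), of s] s by (simp_all add: \<rho>_def)
  have "w = (1 - t) *\<^sub>R x + t *\<^sub>R c" by (simp add: w_def algebra_simps)
  then have "norm w \<le> (1 - t) * norm x + t * norm c"
    using t0 t1 norm_triangle_ineq[of "(1 - t) *\<^sub>R x" "t *\<^sub>R c"] by simp
  then have nw: "norm w \<le> 1 - \<rho> / 2"
    using ts x c by (simp add: algebra_simps)
  then show "x + t *\<^sub>R (c - x) \<in> ball 0 1"
    using \<rho> unfolding w_def[symmetric] by simp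
  have wx: "dist x w \<le> 8 * \<rho>"
  proof -
    have "dist x w = t * norm (c - x)" using t0 by (simp add: w_def dist_norm)
    also have "\<dots> \<le> t * (8 * s)" using xc t0 by (intro mult_left_mono) auto
    finally show ?thesis using ts by simp
  qed
  have ball: "ball w (2 * (\<rho> / 8)) \<subseteq> ball 0 1 \<inter> boundary_box x \<rho>"
  proof
    fix z assume z: "z \<in> ball w (2 * (\<rho> / 8))"
    then have "norm z \<le> norm w + \<rho> / 4" "dist x z \<le> dist x w + \<rho> / 4"
      using norm_triangle_ineq2[of z w] dist_triangle[of x z w] by (auto simp: dist_norm norm_minus_commute)
    then show "z \<in> ball 0 1 \<inter> boundary_box x \<rho>"
      using nw wx \<rho> by (simp add: boundary_box_def)
  qed
  have "(\<lambda>z. (deriv h z)\<^sup>2) holomorphic_on ball w (2 * (\<rho> / 8))"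
    using ball by (intro holomorphic_on_power holomorphic_on_subset[OF holomorphic_deriv[OF h]]) auto
  from holomorphic_area_bound[OF this]
  have "ennreal ((\<rho> / 8)\<^sup>2 * (norm (deriv h w))\<^sup>2)
      \<le> 3 * (\<integral>\<^sup>+z\<in>ball w (2 * (\<rho> / 8)). ennreal ((norm (deriv h z))\<^sup>2) \<partial>lborel)"
    using \<rho> by (simp add: norm_power)
  also have "\<dots> \<le> 3 * energy h (boundary_box x \<rho>)"
    using energy_mono[of "ball w (2 * (\<rho> / 8))" "boundary_box x \<rho>" h] ball by (intro mult_left_mono) (auto simp: energy_def)
  finally have "ennreal 64 * ennreal ((\<rho> / 8)\<^sup>2 * (norm (deriv h w))\<^sup>2) \<le> ennreal 64 * (3 * energy h (boundary_box x \<rho>))"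
    by (intro mult_left_mono) auto
  moreover have "ennreal 64 * ennreal ((\<rho> / 8)\<^sup>2 * (norm (deriv h w))\<^sup>2) = ennreal ((norm (deriv h w) * \<rho>)\<^sup>2)"
  proof -
    have "64 * ((\<rho> / 8)\<^sup>2 * (norm (deriv h w))\<^sup>2) = (norm (deriv h w) * \<rho>)\<^sup>2"
      by (simp add: power_mult_distrib power_divide)
    then show ?thesis by (subst ennreal_mult[symmetric]) auto
  qed
  moreover have "ennreal 64 * (3 * energy h (boundary_box x \<rho>)) = 192 * energy h (boundary_box x \<rho>)"
    by (simp add: mult.assoc[symmetric])
  ultimately show "ennreal ((norm (deriv h (x + t *\<^sub>R (c - x))) * (s / 2 ^ j))\<^sup>2) \<le> 192 * energy h (boundary_box x (s / 2 ^ j))"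
    unfolding w_def \<rho>_def by simp
qed

text \<open>On the j-th piece |h'| \<le> 14 sqrt(E_j) / \<rho> because 192 \<le> 14^2, and the piece
  has length at most 4 \<rho>. The mean value inequality gives 56 sqrt(E_j), and these bounds are
  telescoped starting from c, which is the point at parameter 1.\<close>

lemma log_deriv_osc:
  fixes j :: nat
  assumes h: "h holomorphic_on ball 0 1" and x: "norm x = 1" and c: "norm c = 1 - s"
    and s: "0 < s" "s \<le> 1" and xc: "norm (c - x) \<le> 8 * s"
    and fin: "\<And>j. energy h (boundary_box x (s / 2 ^ j)) < \<infinity>"
    and t: "1 / 2 ^ Suc j \<le> t" "t \<le> 1 / 2 ^ j"
  shows "norm (h (x + t *\<^sub>R (c - x)) - h c) \<le> (\<Sum>i<Suc j. 56 * sqrt (enn2real (energy h (boundary_box x (s / 2 ^ i)))))"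
proof -
  define w where "w t = x + t *\<^sub>R (c - x)" for t :: real
  define E where "E j = enn2real (energy h (boundary_box x (s / 2 ^ j)))" for j :: nat
  have E: "energy h (boundary_box x (s / 2 ^ j)) = ennreal (E j)" "0 \<le> E j" for j
    using fin[of j] by (simp_all add: E_def)
  have step: "norm (h (w t) - h (w (1 / 2 ^ j))) \<le> 56 * sqrt (E j)"
    if t: "1 / 2 ^ Suc j \<le> t" "t \<le> 1 / 2 ^ j" for t and j :: nat
  proof -
    define \<rho> where "\<rho> = s / 2 ^ j"
    have \<rho>: "0 < \<rho>" using s by (simp add: \<rho>_def)
    define S where "S = w ` {1 / 2 ^ Suc j..1 / 2 ^ j}"
    have S: "convex S" unfolding S_def w_def by (rule convex_line_image)
    have "norm (h (w t) - h (w (1 / 2 ^ j))) \<le> (14 * sqrt (E j) / \<rho>) * norm (w t - w (1 / 2 ^ j))"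
    proof (rule field_differentiable_bound[OF S])
      fix z assume "z \<in> S"
      then obtain u where u: "1 / 2 ^ Suc j \<le> u" "u \<le> 1 / 2 ^ j" "z = w u" by (auto simp: S_def)
      note d = deriv_bound_energy[OF h x c s xc u(1,2)]
      have z: "z \<in> ball 0 1" using d(1) u(3) by (simp add: w_def)
      show "(h has_field_derivative deriv h z) (at z within S)"
        using holomorphic_derivI[OF h open_ball z] .
      have "192 * ennreal (E j) = ennreal (192 * E j)"
        using E(2) by (simp add: ennreal_mult)
      then have "(norm (deriv h z) * \<rho>)\<^sup>2 \<le> 192 * E j"
        using d(2) E[of j] u(3) by (simp add: w_def \<rho>_def)
      also have "\<dots> \<le> (14 * sqrt (E j))\<^sup>2" using E(2)[of j] by (simp add: power_mult_distrib)
      finally have "norm (deriv h z) * \<rho> \<le> 14 * sqrt (E j)"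
        by (rule power2_le_imp_le) (use E(2) in auto)
      then show "norm (deriv h z) \<le> 14 * sqrt (E j) / \<rho>"
        using \<rho> by (simp add: pos_le_divide_eq)
    qed (use t in \<open>auto simp: S_def intro!: imageI divide_left_mono\<close>)
    also have "\<dots> \<le> (14 * sqrt (E j) / \<rho>) * ((1 / 2 ^ Suc j) * (8 * s))"
    proof (rule mult_left_mono)
      have "w t - w (1 / 2 ^ j) = (t - 1 / 2 ^ j) *\<^sub>R (c - x)"
        by (simp add: w_def algebra_simps)
      moreover have "\<bar>t - 1 / 2 ^ j\<bar> \<le> 1 / 2 ^ Suc j" using t by simp
      then have "\<bar>t - 1 / 2 ^ j\<bar> * norm (c - x) \<le> (1 / 2 ^ Suc j) * (8 * s)"
        using xc by (intro mult_mono) auto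
      ultimately show "norm (w t - w (1 / 2 ^ j)) \<le> (1 / 2 ^ Suc j) * (8 * s)"
        by (simp only: norm_scaleR)
    qed (use E(2) \<rho> in simp)
    also have "\<dots> = 56 * sqrt (E j)"
      using s by (simp add: \<rho>_def)
    finally show ?thesis .
  qed
  have main: "norm (h (w (1 / 2 ^ j)) - h c) \<le> (\<Sum>i<j. 56 * sqrt (E i))" for j
  proof (induction j)
    case (Suc j)
    have "norm (h (w (1 / 2 ^ Suc j)) - h c) \<le> norm (h (w (1 / 2 ^ Suc j)) - h (w (1 / 2 ^ j))) + norm (h (w (1 / 2 ^ j)) - h c)"
      by norm
    with step[of j "1 / 2 ^ Suc j"] Suc show ?case by (simp add: divide_left_mono)
  qed (simp add: w_def)
  have "norm (h (w t) - h c) \<le> norm (h (w t) - h (w (1 / 2 ^ j))) + norm (h (w (1 / 2 ^ j)) - h c)"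
    by norm
  then show ?thesis using step[OF t] main[of j] by (simp add: w_def E_def)
qed

text \<open>The energy bound is \<open>1 / 5600\<^sup>2\<close>, so that the oscillations \<open>56 * sqrt (energy \<dots>)\<close> of
  \<open>h\<close> are at most \<open>1 / 100\<close>. The ratio \<open>1 / 3\<close> lies between the \<open>(5 / 9)\<^sup>2\<close> needed for Cauchy-Schwarz
  and the \<open>1 / 2\<close> that absorbs a doubling of the weights from scale to scale.\<close>

lemma boundary_linear_approx:
  assumes f: "f holomorphic_on ball 0 1" and fc: "continuous_on (cball 0 1) f"
    and h: "h holomorphic_on ball 0 1" and fh: "\<And>z. z \<in> ball 0 1 \<Longrightarrow> exp (h z) = deriv f z"
    and x: "norm x = 1" and c: "norm c = 1 - s"
    and s: "0 < s" "s \<le> 1" and xc: "norm (c - x) \<le> 8 * s"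
    and small: "\<And>j. energy h (boundary_box x (s / 2 ^ j)) \<le> ennreal (1 / 31360000)"
    and T: "(\<Sum>j. ennreal ((1/3) ^ j) * energy h (boundary_box x (s / 2 ^ j))) \<le> ennreal T" "0 \<le> T"
  shows "norm (f x - f c - deriv f c * (x - c)) \<le> norm (deriv f c) * (s / 4)"
    and "norm (f x - f c - deriv f c * (x - c)) \<le> norm (deriv f c) * (s * sqrt (4233600 * T))"
proof -
  define E where "E j = enn2real (energy h (boundary_box x (s / 2 ^ j)))" for j :: nat
  have fin: "energy h (boundary_box x (s / 2 ^ j)) < \<infinity>" for j
    using small[of j] by (simp add: le_less_trans)
  have E: "energy h (boundary_box x (s / 2 ^ j)) = ennreal (E j)" "0 \<le> E j" for j
    using fin[of j] by (simp_all add: E_def)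
  have E1: "E j \<le> 1 / 31360000" for j using small[of j] E[of j] by (simp del: ennreal_numeral)
  define m where "m j = 56 * sqrt (E j)" for j
  have m0: "0 \<le> m j" for j using E(2)[of j] by (simp add: m_def)
  have m1: "m j \<le> 1 / 100" for j
  proof -
    have "sqrt (E j) \<le> sqrt ((1 / 5600)\<^sup>2)" using E1[of j] by (subst real_sqrt_le_iff) (simp add: power2_eq_square)
    then show ?thesis by (simp add: m_def)
  qed
  have approx: "norm (f (x + (1 / 2 ^ K) *\<^sub>R (c - x)) - f c - deriv f c * (x + (1 / 2 ^ K) *\<^sub>R (c - x) - c))
     \<le> norm (deriv f c) * (10 * s * (\<Sum>j<K. (5/9) ^ j * m j))" for K
  proof (rule radial_linear_approx[OF f fh x _ xc m0 m1])
    show "norm (h (x + t *\<^sub>R (c - x)) - h c) \<le> (\<Sum>i<Suc j. m i)"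
      if "1 / 2 ^ Suc j \<le> t" "t \<le> 1 / 2 ^ j" for j t
      using log_deriv_osc[OF h x c s xc fin that] unfolding m_def E_def .
  qed (use c s in auto)
  \<comment> \<open>The boundary value is reached as K tends to infinity, through the continuity of
    \<open>f\<close> on the closed disc.\<close>
  have lim: "norm (f x - f c - deriv f c * (x - c)) \<le> B"
    if B: "\<And>K. norm (deriv f c) * (10 * s * (\<Sum>j<K. (5/9) ^ j * m j)) \<le> B" for B
  proof -
    let ?w = "\<lambda>K::nat. x + (1 / 2 ^ K) *\<^sub>R (c - x)"
    have "(\<lambda>K::nat. 1 / 2 ^ K :: real) \<longlonglongrightarrow> 0"
      using LIMSEQ_power_zero[of "1/2::real"] by (simp add: power_divide)
    then have "?w \<longlonglongrightarrow> x + 0 *\<^sub>R (c - x)" by (intro tendsto_intros)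
    then have w: "?w \<longlonglongrightarrow> x" by simp
    have "?w K \<in> cball 0 1" for K
      using deriv_bound_energy(1)[OF h x c s xc, of K "1 / 2 ^ K"] by (simp add: divide_left_mono)
    then have "(\<lambda>K. f (?w K)) \<longlonglongrightarrow> f x"
      using continuous_on_tendsto_compose[OF fc w] x by simp
    then have "(\<lambda>K. norm (f (?w K) - f c - deriv f c * (?w K - c))) \<longlonglongrightarrow> norm (f x - f c - deriv f c * (x - c))"
      by (intro tendsto_intros w)
    then show ?thesis
      by (rule LIMSEQ_le_const2) (use approx B order_trans in blast)
  qed
  show "norm (f x - f c - deriv f c * (x - c)) \<le> norm (deriv f c) * (s / 4)"
  proof (rule lim)
    fix K
    \<comment> \<open>The crude bound on the oscillations gives 10 * (9/4) / 100 < 1/4. It keeps the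
      images of two endpoints apart but does not become small with the energy.\<close>
    have "(\<Sum>j<K. (5/9) ^ j * m j) \<le> (\<Sum>j<K. (5/9) ^ j * (1 / 100))"
      by (intro sum_mono mult_left_mono m1) auto
    also have "\<dots> = (\<Sum>j<K. (5/9) ^ j) * (1 / 100)" by (simp add: sum_distrib_right)
    also have "\<dots> = (1 - (5/9) ^ K) / (1 - 5/9) * (1 / 100)" by (subst sum_gp_strict) auto
    also have "\<dots> \<le> 1 / (1 - 5/9) * (1 / 100)" by (intro mult_right_mono divide_right_mono) auto
    also have "\<dots> \<le> 1 / 40" by simp
    finally have "10 * s * (\<Sum>j<K. (5/9) ^ j * m j) \<le> 10 * s * (1 / 40)"
      using s by (intro mult_left_mono) auto
    then show "norm (deriv f c) * (10 * s * (\<Sum>j<K. (5/9) ^ j * m j)) \<le> norm (deriv f c) * (s / 4)"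
      by (intro mult_left_mono) auto
  qed
  show "norm (f x - f c - deriv f c * (x - c)) \<le> norm (deriv f c) * (s * sqrt (4233600 * T))"
  proof (rule lim)
    fix K
    have "ennreal (\<Sum>j<K. (1/3) ^ j * E j) = (\<Sum>j<K. ennreal ((1/3) ^ j) * energy h (boundary_box x (s / 2 ^ j)))"
      using E by (subst sum_ennreal[symmetric]) (auto simp: ennreal_mult)
    also have "\<dots> \<le> (\<Sum>j. ennreal ((1/3) ^ j) * energy h (boundary_box x (s / 2 ^ j)))"
      by (intro sum_le_suminf) auto
    also note T(1)
    finally have TK: "(\<Sum>j<K. (1/3) ^ j * E j) \<le> T" using T(2) by (simp add: ennreal_le_iff)
    \<comment> \<open>The weight sqrt(3)^j leaves the ratio (5/9)^2 * 3 = 25/27 < 1 in one factor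
      and 1/3 in the other. The constant is 100 * (27/2) * 56^2 = 4233600.\<close>
    have "(\<Sum>j<K. (5/9) ^ j * m j)\<^sup>2 = (\<Sum>j<K. ((5/9) ^ j * sqrt 3 ^ j) * (m j / sqrt 3 ^ j))\<^sup>2"
      by simp
    also have "\<dots> \<le> (\<Sum>j<K. ((5/9) ^ j * sqrt 3 ^ j)\<^sup>2) * (\<Sum>j<K. (m j / sqrt 3 ^ j)\<^sup>2)"
      by (rule Cauchy_Schwarz_ineq_sum)
    also have "(\<Sum>j<K. ((5/9) ^ j * sqrt 3 ^ j)\<^sup>2) = (\<Sum>j<K. (25/27) ^ j)"
    proof (rule sum.cong)
      fix j :: nat
      have "((5/9) ^ j * sqrt 3 ^ j)\<^sup>2 = ((5/9 * sqrt 3)\<^sup>2) ^ j"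
        by (simp only: power_mult_distrib[symmetric] power2_eq_square)
      also have "(5/9 * sqrt 3)\<^sup>2 = (25/27 :: real)" by (simp add: power_mult_distrib power2_eq_square)
      finally show "((5/9) ^ j * sqrt 3 ^ j)\<^sup>2 = (25/27 :: real) ^ j" .
    qed simp
    also have "(\<Sum>j<K. (m j / sqrt 3 ^ j)\<^sup>2) = (\<Sum>j<K. 3136 * ((1/3) ^ j * E j))"
    proof (rule sum.cong)
      fix j :: nat
      have "(sqrt 3 ^ j)\<^sup>2 = (3 :: real) ^ j" by (simp add: power2_eq_square flip: power_mult_distrib)
      then show "(m j / sqrt 3 ^ j)\<^sup>2 = 3136 * ((1/3) ^ j * E j)"
        using E(2)[of j] by (simp add: m_def power_divide power_mult_distrib)
    qed simp
    also have "(\<Sum>j<K. (25/27) ^ j) * (\<Sum>j<K. 3136 * ((1/3) ^ j * E j)) \<le> (27/2) * (3136 * T)"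
    proof (rule mult_mono)
      have "(\<Sum>j<K. (25/27 :: real) ^ j) = (1 - (25/27) ^ K) / (1 - 25/27)" by (subst sum_gp_strict) auto
      then show "(\<Sum>j<K. (25/27 :: real) ^ j) \<le> 27 / 2" by simp
      show "(\<Sum>j<K. 3136 * ((1/3) ^ j * E j)) \<le> 3136 * T"
        using TK by (simp flip: sum_distrib_left)
      show "0 \<le> (\<Sum>j<K. 3136 * ((1/3) ^ j * E j))" using E(2) by (intro sum_nonneg) auto
    qed simp
    finally have "(10 * s * (\<Sum>j<K. (5/9) ^ j * m j))\<^sup>2 \<le> (s * sqrt (4233600 * T))\<^sup>2"
      using T(2) s by (simp add: power_mult_distrib mult_left_mono field_simps)
    then have "10 * s * (\<Sum>j<K. (5/9) ^ j * m j) \<le> s * sqrt (4233600 * T)"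
      by (rule power2_le_imp_le) (use s T(2) in simp)
    then show "norm (deriv f c) * (10 * s * (\<Sum>j<K. (5/9) ^ j * m j)) \<le> norm (deriv f c) * (s * sqrt (4233600 * T))"
      by (intro mult_left_mono) auto
  qed
qed

subsection \<open>Beta numbers and energy\<close>

lemma half_le_sin:
  fixes x :: real
  assumes "0 \<le> x" "x \<le> pi / 2"
  shows "x / 2 \<le> sin x"
proof -
  \<comment> \<open>On this interval x^2 \<le> 3, so the cubic Taylor bound x - x^3/6 for the sine
    is at least x/2.\<close>
  have "x \<le> 1.6" using assms pi_approx by simp
  then have "x\<^sup>2 \<le> 1.6\<^sup>2" using assms by (intro power_mono) auto
  then have "x * x\<^sup>2 \<le> x * 3" using assms by (intro mult_left_mono) (auto simp: power2_eq_square)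
  moreover have "\<bar>sin x - x\<bar> \<le> x ^ 3 / 6"
  proof -
    have "(\<Sum>m<3. sin_coeff m * x ^ m) = x" by (simp add: eval_nat_numeral sin_coeff_def)
    moreover have "inverse (fact 3) * \<bar>x\<bar> ^ 3 = x ^ 3 / (6::real)" using assms by (simp add: fact_numeral)
    ultimately show ?thesis using Maclaurin_sin_bound[of x 3] by (simp only:)
  qed
  moreover have "x * x\<^sup>2 = x ^ 3" by (simp add: power2_eq_square power3_eq_cube)
  ultimately show ?thesis by linarith
qed

lemma norm_cis_diff: "norm (cis a - cis b) = 2 * \<bar>sin ((a - b) / 2)\<bar>"
proof -
  have "cis a - cis b = cis ((a + b) / 2) * (cis ((a - b) / 2) - cis (- ((a - b) / 2)))"
    by (simp add: right_diff_distrib cis_mult field_simps)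
  also have "cis ((a - b) / 2) - cis (- ((a - b) / 2)) = 2 * \<i> * of_real (sin ((a - b) / 2))"
    by (simp add: complex_eq_iff)
  finally show ?thesis by (simp add: norm_mult)
qed

lemma norm_cis_diff_ge:
  assumes "\<bar>u - v\<bar> \<le> 1 / 2"
  shows "3 * \<bar>u - v\<bar> \<le> norm (cis (2 * pi * u) - cis (2 * pi * v))"
proof -
  have "norm (cis (2 * pi * u) - cis (2 * pi * v)) = 2 * \<bar>sin (pi * (u - v))\<bar>"
    unfolding norm_cis_diff by (simp add: right_diff_distrib[symmetric] mult.assoc)
  also have "\<bar>sin (pi * (u - v))\<bar> = \<bar>sin (pi * \<bar>u - v\<bar>)\<bar>" 
  proof -
    have "\<bar>sin (pi * t)\<bar> = \<bar>sin (pi * \<bar>t\<bar>)\<bar>" for t by (cases "0 \<le> t") auto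
    then show ?thesis .
  qed
  also have "pi * \<bar>u - v\<bar> / 2 \<le> sin (pi * \<bar>u - v\<bar>)"
    using assms by (intro half_le_sin) auto
  then have "2 * (pi * \<bar>u - v\<bar> / 2) \<le> 2 * \<bar>sin (pi * \<bar>u - v\<bar>)\<bar>" by linarith
  finally have "pi * \<bar>u - v\<bar> \<le> norm (cis (2 * pi * u) - cis (2 * pi * v))" by simp
  moreover have "3 * \<bar>u - v\<bar> \<le> pi * \<bar>u - v\<bar>" using pi_gt3 by (intro mult_right_mono) auto
  ultimately show ?thesis by linarith
qed

lemma norm_cis_diff_le: "norm (cis (2 * pi * u) - cis (2 * pi * v)) \<le> 7 * \<bar>u - v\<bar>"
proof -
  have "norm (cis (2 * pi * u) - cis (2 * pi * v)) = 2 * \<bar>sin (pi * (u - v))\<bar>"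
    unfolding norm_cis_diff by (simp add: right_diff_distrib[symmetric] mult.assoc)
  also have "\<dots> \<le> 2 * (pi * \<bar>u - v\<bar>)"
    using abs_sin_x_le_abs_x[of "pi * (u - v)"] by (simp add: abs_mult)
  also have "\<dots> = (2 * pi) * \<bar>u - v\<bar>" by simp
  also have "\<dots> \<le> 7 * \<bar>u - v\<bar>" using pi_approx by (intro mult_right_mono) auto
  finally show ?thesis .
qed

lemma norm_cis_taylor: "norm (cis t - 1 - \<i> * of_real t) \<le> t\<^sup>2"
  using Taylor_exp[of "\<i> * of_real t" 1] by (simp add: cis_conv_exp norm_mult power2_eq_square diff_diff_eq)

lemma path_image_arc_path:
  "0 \<le> l \<Longrightarrow> path_image (arc_path (a, l)) = {cis (2 * pi * \<theta>) | \<theta>. a \<le> \<theta> \<and> \<theta> \<le> a + l}"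
  using arc_set_eq[of l a] by (simp add: arc_set_def)

lemma pathstart_arc_path [simp]: "pathstart (arc_path (a, l)) = cis (2 * pi * a)"
  and pathfinish_arc_path [simp]: "pathfinish (arc_path (a, l)) = cis (2 * pi * (a + l))"
  by (simp_all add: arc_path_def cis_conv_exp)

text \<open>After rotating \<open>a\<close> to angle 0, the linear Taylor terms of the arc and of
  the chord cancel, the parameter on the chord being proportional to the angle. Two quadratic
  remainders of at most (2 pi l)^2 are left, and 8 pi^2 < 80.\<close>

lemma arc_chord_deviation:
  assumes l: "0 < l" and \<theta>: "a \<le> \<theta>" "\<theta> \<le> a + l"
  shows "norm (cis (2 * pi * \<theta>) - cis (2 * pi * a) - of_real ((\<theta> - a) / l) * (cis (2 * pi * (a + l)) - cis (2 * pi * a)))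
    \<le> 80 * l\<^sup>2"
proof -
  define \<mu> where "\<mu> = (\<theta> - a) / l"
  have \<mu>: "0 \<le> \<mu>" "\<mu> \<le> 1" "\<mu> * l = \<theta> - a" using assms by (auto simp: \<mu>_def)
  define R where "R t = cis t - 1 - \<i> * of_real t" for t
  have R: "norm (R t) \<le> (2 * pi * l)\<^sup>2" if "\<bar>t\<bar> \<le> 2 * pi * l" for t
    using norm_cis_taylor[of t] that power_mono[OF that, of 2] unfolding R_def by simp
  have c: "cis (2 * pi * u) = cis (2 * pi * a) * cis (2 * pi * (u - a))" for u
    by (simp add: cis_mult algebra_simps)
  have "cis (2 * pi * \<theta>) - cis (2 * pi * a) - of_real \<mu> * (cis (2 * pi * (a + l)) - cis (2 * pi * a)) =
      cis (2 * pi * a) * (cis (2 * pi * (\<theta> - a)) - 1 - of_real \<mu> * (cis (2 * pi * l) - 1))"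
    unfolding c[of \<theta>] c[of "a + l"] by (simp add: algebra_simps)
  also have "cis (2 * pi * (\<theta> - a)) - 1 - of_real \<mu> * (cis (2 * pi * l) - 1) =
      R (2 * pi * (\<theta> - a)) - of_real \<mu> * R (2 * pi * l)"
    unfolding \<mu>(3)[symmetric] by (simp add: R_def algebra_simps)
  finally have "norm (cis (2 * pi * \<theta>) - cis (2 * pi * a) - of_real \<mu> * (cis (2 * pi * (a + l)) - cis (2 * pi * a)))
    = norm (R (2 * pi * (\<theta> - a)) - of_real \<mu> * R (2 * pi * l))"
    by (simp add: norm_mult)
  also have "\<dots> \<le> norm (R (2 * pi * (\<theta> - a))) + \<mu> * norm (R (2 * pi * l))"
    using norm_triangle_ineq4[of "R (2 * pi * (\<theta> - a))" "of_real \<mu> * R (2 * pi * l)"] \<mu> by (simp add: norm_mult)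
  also have "\<dots> \<le> (2 * pi * l)\<^sup>2 + 1 * (2 * pi * l)\<^sup>2"
    using assms \<mu> by (intro add_mono mult_mono R) (auto simp: abs_mult)
  also have "\<dots> = (8 * pi\<^sup>2) * l\<^sup>2" by (simp add: power_mult_distrib)
  also have "pi\<^sup>2 \<le> 3.16\<^sup>2" using pi_approx by (intro power_mono) auto
  then have "(8 * pi\<^sup>2) * l\<^sup>2 \<le> 80 * l\<^sup>2" by (intro mult_right_mono) (auto simp: power2_eq_square)
  finally show ?thesis by (simp add: \<mu>_def)
qed

text \<open>A nonconstant affine map of the plane preserves \<beta>, so only the error relative to
  |D| matters. The chord keeps length at least (3 - 1/2) l |D|, which exceeds 2 l |D|, and the
  deviation from it is at most |D| (80 l^2 + 2 \<epsilon>).\<close>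

lemma beta_le_of_linear_approx:
  assumes l: "0 < l" "l \<le> 1 / 2" and D: "D \<noteq> 0"
    and approx: "\<And>\<theta>. a \<le> \<theta> \<Longrightarrow> \<theta> \<le> a + l \<Longrightarrow>
        norm (f (cis (2 * pi * \<theta>)) - f c - D * (cis (2 * pi * \<theta>) - c)) \<le> norm D * \<epsilon>"
    and \<epsilon>: "\<epsilon> \<le> l / 4"
  shows "0 \<le> beta (f \<circ> arc_path (a, l))" "beta (f \<circ> arc_path (a, l)) \<le> 40 * l + \<epsilon> / l"
proof -
  define x where "x \<theta> = cis (2 * pi * \<theta>)" for \<theta>
  define w1 w2 where "w1 = f (x a)" and "w2 = f (x (a + l))"
  have ends: "pathstart (f \<circ> arc_path (a, l)) = w1" "pathfinish (f \<circ> arc_path (a, l)) = w2"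
    by (simp_all add: pathstart_compose pathfinish_compose w1_def w2_def x_def)
  define R where "R \<theta> = f (x \<theta>) - f c - D * (x \<theta> - c)" for \<theta>
  have R: "norm (R \<theta>) \<le> norm D * \<epsilon>" if "a \<le> \<theta>" "\<theta> \<le> a + l" for \<theta>
    using approx[OF that] by (simp add: R_def x_def)
  have img: "path_image (f \<circ> arc_path (a, l)) = (\<lambda>\<theta>. f (x \<theta>)) ` {a..a + l}"
    using l by (simp add: path_image_compose path_image_arc_path x_def) (auto simp: image_def; blast)
  have D0: "0 < norm D" using D by simp
  have chord: "norm D * (2 * l) \<le> dist w1 w2"
  proof -
    have "3 * l \<le> norm (x a - x (a + l))"
      using norm_cis_diff_ge[of a "a + l"] l by (simp add: x_def)
    then have "norm D * (3 * l) \<le> norm (D * (x a - x (a + l)))"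
      using D0 by (simp add: norm_mult)
    also have "D * (x a - x (a + l)) = (w1 - w2) + (R (a + l) - R a)"
      by (simp add: R_def w1_def w2_def algebra_simps)
    also have "norm \<dots> \<le> dist w1 w2 + (norm D * \<epsilon> + norm D * \<epsilon>)"
      using norm_triangle_ineq[of "w1 - w2" "R (a + l) - R a"] norm_triangle_ineq4[of "R (a + l)" "R a"]
        R[of a] R[of "a + l"] l unfolding dist_norm by linarith
    also have "norm D * \<epsilon> \<le> norm D * (l / 4)" using \<epsilon> by (intro mult_left_mono) auto
    finally have "norm D * (3 * l) \<le> dist w1 w2 + (norm D * (l / 4) + norm D * (l / 4))" by simp
    moreover have "0 \<le> norm D * l" using l by simp
    ultimately show ?thesis by (simp add: algebra_simps)
  qed
  have dev: "infdist w (affine hull {w1, w2}) \<le> norm D * (80 * l\<^sup>2 + 2 * \<epsilon>)"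
    if w: "w \<in> path_image (f \<circ> arc_path (a, l))" for w
  proof -
    obtain \<theta> where \<theta>: "a \<le> \<theta>" "\<theta> \<le> a + l" "w = f (x \<theta>)" using w img by auto
    define \<mu> where "\<mu> = (\<theta> - a) / l"
    have \<mu>: "0 \<le> \<mu>" "\<mu> \<le> 1" using \<theta> l by (auto simp: \<mu>_def)
    \<comment> \<open>The point of the line with proportional parameter serves as competitor; an
      orthogonal projection is not computed.\<close>
    define p where "p = (1 - \<mu>) *\<^sub>R w1 + \<mu> *\<^sub>R w2"
    have "p \<in> affine hull {w1, w2}" unfolding affine_hull_2 p_def by force
    then have "infdist w (affine hull {w1, w2}) \<le> dist w p" by (rule infdist_le)
    also have "w - p = D * (x \<theta> - x a - of_real \<mu> * (x (a + l) - x a)) + (R \<theta> - ((1 - \<mu>) *\<^sub>R R a + \<mu> *\<^sub>R R (a + l)))"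
      by (simp add: \<theta>(3) p_def R_def w1_def w2_def scaleR_conv_of_real algebra_simps)
    then have "dist w p \<le> norm D * norm (x \<theta> - x a - of_real \<mu> * (x (a + l) - x a)) +
        (norm (R \<theta>) + ((1 - \<mu>) * norm (R a) + \<mu> * norm (R (a + l))))"
      unfolding dist_norm using \<mu>
      by (auto simp: norm_mult intro!: norm_triangle_le norm_triangle_le_diff add_mono)
    also have "\<dots> \<le> norm D * (80 * l\<^sup>2) + (norm D * \<epsilon> + ((1 - \<mu>) * (norm D * \<epsilon>) + \<mu> * (norm D * \<epsilon>)))"
      using arc_chord_deviation[OF l(1) \<theta>(1,2)] R \<theta> l \<mu>
      by (intro add_mono mult_left_mono) (auto simp: x_def \<mu>_def)
    also have "\<dots> = norm D * (80 * l\<^sup>2 + 2 * \<epsilon>)" by (simp add: algebra_simps)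
    finally show ?thesis .
  qed
  define S where "S = (SUP w\<in>path_image (f \<circ> arc_path (a, l)). infdist w (affine hull {w1, w2}))"
  have ne: "w1 \<in> path_image (f \<circ> arc_path (a, l))" using l by (auto simp: img w1_def)
  have S: "S \<le> norm D * (80 * l\<^sup>2 + 2 * \<epsilon>)"
    unfolding S_def using ne by (intro cSUP_least dev) auto
  \<comment> \<open>\<open>SUP\<close> over the reals is meaningful only for nonempty sets bounded
    above; the bound \<open>dev\<close> supplies boundedness here.\<close>
  have "infdist w1 (affine hull {w1, w2}) \<le> S"
    unfolding S_def by (rule cSUP_upper[OF ne]) (use dev in \<open>auto intro!: bdd_aboveI2\<close>)
  then have S0: "0 \<le> S" using infdist_nonneg order_trans by blast
  have b: "beta (f \<circ> arc_path (a, l)) = S / dist w1 w2"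
    unfolding beta_def ends S_def by simp
  show "0 \<le> beta (f \<circ> arc_path (a, l))" unfolding b using S0 by simp
  have "S / dist w1 w2 \<le> S / (norm D * (2 * l))"
    using chord D0 l S0 by (intro divide_left_mono) (auto intro!: mult_pos_pos less_le_trans[OF _ chord])
  also have "\<dots> \<le> norm D * (80 * l\<^sup>2 + 2 * \<epsilon>) / (norm D * (2 * l))"
    using S D0 l by (intro divide_right_mono) auto
  also have "\<dots> = 40 * l + \<epsilon> / l" using D0 l by (simp add: field_simps power2_eq_square)
  finally show "beta (f \<circ> arc_path (a, l)) \<le> 40 * l + \<epsilon> / l" unfolding b .
qed

text \<open>The layer at height about \<open>l / 2 ^ j\<close> of a box over the arc \<open>(a, l)\<close>: it contains
  \<open>boundary_box x (l / 2 ^ j)\<close> for every point \<open>x\<close> of the arc.\<close>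

definition arc_layer :: "real \<Rightarrow> real \<Rightarrow> nat \<Rightarrow> complex set" where
  "arc_layer a l j = {z. l / 2 ^ j / 4 \<le> 1 - norm z \<and> 1 - norm z \<le> 9 * (l / 2 ^ j) \<and> dist (cis (2 * pi * a)) z \<le> 16 * l}"

text \<open>One base point c at height l above the initial endpoint serves all points of the arc,
  and the layers of the arc contain their boundary boxes. Hence a single energy series controls the
  linear approximation on the whole arc.\<close>

lemma beta_square_le_energy:
  assumes f: "f holomorphic_on ball 0 1" and fc: "continuous_on (cball 0 1) f"
    and h: "log_deriv_branch f h"
    and l: "0 < l" "l \<le> 1 / 2"
    and small: "\<And>x r. norm x = 1 \<Longrightarrow> 0 < r \<Longrightarrow> r \<le> l \<Longrightarrow> energy h (boundary_box x r) \<le> ennreal (1 / 31360000)"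
  shows "ennreal ((beta (f \<circ> arc_path (a, l)))\<^sup>2) \<le>
    ennreal (10 ^ 7) * (ennreal (l\<^sup>2) + (\<Sum>j. ennreal ((1/3) ^ j) * energy h (arc_layer a l j)))"
proof (cases "(\<Sum>j. ennreal ((1/3) ^ j) * energy h (arc_layer a l j))")
  case (real T)
  have h': "h holomorphic_on ball 0 1" "\<And>z. z \<in> ball 0 1 \<Longrightarrow> exp (h z) = deriv f z"
    using h by (auto simp: log_deriv_branch_def)
  define c where "c = (1 - l) *\<^sub>R cis (2 * pi * a)"
  have c: "norm c = 1 - l" using l by (simp add: c_def)
  \<comment> \<open>The first bound keeps the endpoints of the image apart; the second carries the
    energy.\<close>
  define \<epsilon> where "\<epsilon> = min (l / 4) (l * sqrt (4233600 * T))"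
  have D: "deriv f c \<noteq> 0" using h'(2)[of c] c l by (metis exp_not_eq_zero mem_ball_0 diff_less_eq less_add_same_cancel1)
  have approx: "norm (f (cis (2 * pi * \<theta>)) - f c - deriv f c * (cis (2 * pi * \<theta>) - c)) \<le> norm (deriv f c) * \<epsilon>"
    if \<theta>: "a \<le> \<theta>" "\<theta> \<le> a + l" for \<theta>
  proof -
    let ?x = "cis (2 * pi * \<theta>)"
    have ax: "norm (cis (2 * pi * a) - ?x) \<le> 7 * l"
      using norm_cis_diff_le[of a \<theta>] \<theta> by simp
    have "c - ?x = (cis (2 * pi * a) - ?x) - l *\<^sub>R cis (2 * pi * a)" by (simp add: c_def algebra_simps)
    then have "norm (c - ?x) \<le> norm (cis (2 * pi * a) - ?x) + norm (l *\<^sub>R cis (2 * pi * a))"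
      by (metis norm_triangle_ineq4)
    then have cx: "norm (c - ?x) \<le> 8 * l" using ax l by simp
    \<comment> \<open>Points of the arc are within 7 l of its start and the box reaches at most 9 l
      further; this is the radius 16 l of the layer.\<close>
    have sub: "boundary_box ?x (l / 2 ^ j) \<subseteq> arc_layer a l j" for j
    proof
      fix z assume z: "z \<in> boundary_box ?x (l / 2 ^ j)"
      have "1 - norm z \<le> dist ?x z" using norm_triangle_ineq2[of ?x z] by (simp add: dist_norm)
      moreover have "dist (cis (2 * pi * a)) z \<le> 7 * l + dist ?x z"
        using dist_triangle[of "cis (2 * pi * a)" z ?x] ax by (simp add: dist_norm)
      moreover have "l / 2 ^ j \<le> l" using l by (simp add: divide_le_eq_1 field_simps)
      ultimately show "z \<in> arc_layer a l j" using z by (auto simp: boundary_box_def arc_layer_def)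
    qed
    have "(\<Sum>j. ennreal ((1/3) ^ j) * energy h (boundary_box ?x (l / 2 ^ j)))
        \<le> (\<Sum>j. ennreal ((1/3) ^ j) * energy h (arc_layer a l j))"
      by (intro suminf_le mult_left_mono energy_mono sub) auto
    then have T: "(\<Sum>j. ennreal ((1/3) ^ j) * energy h (boundary_box ?x (l / 2 ^ j))) \<le> ennreal T"
      using real by simp
    have sm: "energy h (boundary_box ?x (l / 2 ^ j)) \<le> ennreal (1 / 31360000)" for j
      using l by (intro small) (auto simp: field_simps)
    note * = boundary_linear_approx[OF f fc h' _ c l(1) _ cx sm T real(1)]
    have "norm (deriv f c) * \<epsilon> = min (norm (deriv f c) * (l / 4)) (norm (deriv f c) * (l * sqrt (4233600 * T)))"
      by (simp add: \<epsilon>_def min_mult_distrib_left)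
    then show ?thesis using * l by simp
  qed
  note b = beta_le_of_linear_approx[OF l D approx, unfolded \<epsilon>_def, OF _ _ min.cobounded1, folded \<epsilon>_def]
  have "beta (f \<circ> arc_path (a, l)) \<le> 40 * l + \<epsilon> / l" using b by blast
  also have "\<epsilon> / l \<le> sqrt (4233600 * T)"
    using l by (simp add: \<epsilon>_def pos_divide_le_eq mult.commute)
  finally have "(beta (f \<circ> arc_path (a, l)))\<^sup>2 \<le> (40 * l + sqrt (4233600 * T))\<^sup>2"
    using b by (intro power_mono) auto
  \<comment> \<open>By (x + y)^2 \<le> 2 x^2 + 2 y^2 the coefficients are 3200 and 8467200, both
    below 10^7.\<close>
  also have "\<dots> \<le> 2 * (40 * l)\<^sup>2 + 2 * (sqrt (4233600 * T))\<^sup>2"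
    using sum_squares_bound[of "40 * l" "sqrt (4233600 * T)"] by (simp add: power2_sum)
  also have "\<dots> \<le> 10 ^ 7 * (l\<^sup>2 + T)" using real l by (simp add: power_mult_distrib)
  finally have "ennreal ((beta (f \<circ> arc_path (a, l)))\<^sup>2) \<le> ennreal (10 ^ 7 * (l\<^sup>2 + T))"
    by (rule ennreal_leI)
  also have "\<dots> = ennreal (10 ^ 7) * (ennreal (l\<^sup>2) + ennreal T)"
    using real by (subst ennreal_mult) (auto simp: ennreal_plus)
  finally show ?thesis using real by simp
next
  case top
  then show ?thesis by (simp add: ennreal_mult_top)
qed

subsection \<open>Summation over dyadic arcs\<close>

definition dyadic_arc :: "nat \<times> nat \<Rightarrow> circle_arc" where
  "dyadic_arc = (\<lambda>(n, k). (real k / 2 ^ n, 1 / 2 ^ n))"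

lemma dyadic_arcs_eq: "dyadic_arcs = dyadic_arc ` {(n, k). 1 \<le> n \<and> k < 2 ^ n}"
  by (auto simp: dyadic_arcs_def dyadic_arc_def)

lemma inj_dyadic_arc: "inj dyadic_arc"
  by (rule injI) (auto simp: dyadic_arc_def split: prod.splits)

text \<open>Two such starting points are within 32 / 2^n of each other, so by the chord estimate
  their indices differ by at most 10 modulo 2^n. This leaves a window of 21 indices about
  \<open>k0\<close>, together with 11 at the beginning and 10 at the end for wraparound.\<close>

lemma card_dyadic_arcs_near:
  "card {k. k < 2 ^ n \<and> dist (cis (2 * pi * (real k / 2 ^ n))) z \<le> 16 * (1 / 2 ^ n)} \<le> 42"
proof -
  let ?S = "{k. k < 2 ^ n \<and> dist (cis (2 * pi * (real k / 2 ^ n))) z \<le> 16 * (1 / 2 ^ n)}"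
  show ?thesis
  proof (cases "?S = {}")
    case False
    then obtain k0 where k0: "k0 \<in> ?S" by blast
    have close: "k \<in> {k0 - 10..k0 + 10} \<union> {..10} \<union> {2 ^ n - 10..<2 ^ n}" if k: "k \<in> ?S" for k
    proof -
      define u v where "u = real k / 2 ^ n" and "v = real k0 / 2 ^ n"
      have lt: "k < 2 ^ n" "k0 < 2 ^ n" using k k0 by simp_all
      have "real k < real (2 ^ n)" "real k0 < real (2 ^ n)" using lt by (simp_all only: of_nat_less_iff)
      then have uv: "0 \<le> u" "u < 1" "0 \<le> v" "v < 1"
        by (simp_all add: u_def v_def divide_less_eq_1)
      have d: "norm (cis (2 * pi * u) - cis (2 * pi * v)) \<le> 32 * (1 / 2 ^ n)"
        using k k0 dist_triangle2[of "cis (2 * pi * u)" "cis (2 * pi * v)" z] by (simp add: u_def v_def dist_norm)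
      have per: "cis (2 * pi * (v + 1)) = cis (2 * pi * v)" "cis (2 * pi * (v - 1)) = cis (2 * pi * v)"
        using cis_mult[of "2 * pi * v" "2 * pi"] cis_divide[of "2 * pi * v" "2 * pi"] by (simp_all add: distrib_left right_diff_distrib)
      \<comment> \<open>A full turn is added or removed so that the parameters differ by at most
        half a turn, where chord length controls angle.\<close>
      have "\<exists>e\<in>{-1, 0, 1 :: int}. \<bar>u - (v + of_int e)\<bar> \<le> 1 / 2"
        using uv by (simp add: abs_if) linarith
      then obtain e :: int where e: "e \<in> {-1, 0, 1}" "\<bar>u - (v + of_int e)\<bar> \<le> 1 / 2" by blast
      have "cis (2 * pi * (v + of_int e)) = cis (2 * pi * v)" using e(1) per by auto
      then have "3 * \<bar>u - (v + of_int e)\<bar> \<le> 32 * (1 / 2 ^ n)"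
        using norm_cis_diff_ge[OF e(2)] d by simp
      moreover have "u - (v + of_int e) = real_of_int (int k - int k0 - e * 2 ^ n) / 2 ^ n"
        by (simp add: u_def v_def field_simps)
      ultimately have "3 * \<bar>real_of_int (int k - int k0 - e * 2 ^ n)\<bar> \<le> 32"
        by (simp add: field_simps)
      moreover have "\<bar>m\<bar> \<le> 10" if "3 * \<bar>real_of_int m\<bar> \<le> 32" for m :: int using that by linarith
      ultimately have near: "\<bar>int k - int k0 - e * 2 ^ n\<bar> \<le> 10" by blast
      have bnd: "int k < 2 ^ n" "int k0 < 2 ^ n"
        using lt by (metis of_nat_less_iff of_nat_numeral of_nat_power)+
      have "\<bar>int k - int k0\<bar> \<le> 10 \<or> int k \<le> 10 \<or> 2 ^ n \<le> int k + 10"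
      proof -
        have "\<bar>a - b\<bar> \<le> 10 \<or> a \<le> 10 \<or> M \<le> a + 10"
          if "\<bar>a - b - e * M\<bar> \<le> 10" "a < M" "b < M" "0 \<le> b" for a b M :: int
          using that e(1) by auto
        from this[OF near bnd of_nat_0_le_iff] show ?thesis .
      qed
      moreover note lt(1)
      moreover have "2 ^ n \<le> int k + 10 \<Longrightarrow> 2 ^ n \<le> k + 10"
        by (metis of_nat_add of_nat_le_iff of_nat_numeral of_nat_power)
      ultimately show ?thesis by auto
    qed
    have "card ?S \<le> card ({k0 - 10..k0 + 10} \<union> {..10} \<union> {2 ^ n - 10..<2 ^ n})"
    proof (rule card_mono)
      show "?S \<subseteq> {k0 - 10..k0 + 10} \<union> {..10} \<union> {2 ^ n - 10..<2 ^ n}" using close by blast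
    qed simp
    also have "\<dots> \<le> card {k0 - 10..k0 + 10} + card {..10::nat} + card {2 ^ n - 10..<2 ^ n::nat}"
      by (meson add_le_mono1 card_Un_le le_trans)
    also have "\<dots> \<le> 42" by simp
    finally show ?thesis .
  next
    case True
    then show ?thesis by (simp only: card.empty)
  qed
qed

text \<open>The condition confines 2^n d to [1/4, 9]. The quotient of these ends is 36 < 2^6, so six
  consecutive scales suffice.\<close>

lemma card_dyadic_scales:
  assumes "finite N" and d: "\<And>n. n \<in> N \<Longrightarrow> 1 / 2 ^ n / 4 \<le> (d::real) \<and> d \<le> 9 * (1 / 2 ^ n)"
  shows "card N \<le> 6"
proof (cases "N = {}")
  case False
  define n0 where "n0 = Min N"
  have n0: "n0 \<in> N" using False assms(1) by (simp add: n0_def)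
  have "n \<in> {n0..<n0 + 6}" if n: "n \<in> N" for n
  proof -
    have le: "n0 \<le> n" using n assms(1) by (simp add: n0_def)
    have "1 / 2 ^ n0 / 4 \<le> 9 * (1 / 2 ^ n :: real)" using d[OF n] d[OF n0] by linarith
    then have "2 ^ n \<le> 36 * (2 ^ n0 :: real)" by (simp add: field_simps)
    also have "2 ^ n = 2 ^ n0 * (2 ^ (n - n0) :: real)" using le by (simp flip: power_add)
    finally have "2 ^ (n - n0) < (2::real) ^ 6" by simp
    then have "n - n0 < 6" by (rule power_less_imp_less_exp[rotated]) simp
    then show ?thesis using le by auto
  qed
  then have "card N \<le> card {n0..<n0 + 6}" by (intro card_mono) auto
  then show ?thesis by simp
qed simp

text \<open>For fixed j the height of z must match scale n + j, which leaves 6 values of n and 42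
  arcs for each. The weight satisfies w(n) \<le> 2^j w(n + j) \<le> 2^j W, so with the factor 3^-j
  the j-th term is at most 252 W (2/3)^j. Summing over j gives 3 * 252 = 756.\<close>

lemma arc_layer_overlap:
  fixes w :: "nat \<Rightarrow> real"
  assumes P: "finite P" "\<And>n k. (n, k) \<in> P \<Longrightarrow> n0 \<le> n \<and> k < 2 ^ n"
    and w: "\<And>n. 0 \<le> w n" "\<And>n j. w n \<le> 2 ^ j * w (n + j)"
    and W: "0 \<le> W" "\<And>m. n0 \<le> m \<Longrightarrow> 1 / 2 ^ m / 4 \<le> 1 - norm z \<Longrightarrow> 1 - norm z \<le> 9 * (1 / 2 ^ m) \<Longrightarrow> w m \<le> W"
  shows "(\<Sum>(n, k)\<in>P. \<Sum>j. ennreal (w n * (1/3) ^ j * indicator (arc_layer (real k / 2 ^ n) (1 / 2 ^ n) j) z)) \<le> ennreal (756 * W)"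
proof -
  define N where "N = fst ` P"
  have N: "finite N" "\<And>n. n \<in> N \<Longrightarrow> n0 \<le> n" using P by (auto simp: N_def)
  define c where "c m = (if 1 / 2 ^ m / 4 \<le> 1 - norm z \<and> 1 - norm z \<le> 9 * (1 / 2 ^ m) then 1 else 0 :: real)" for m :: nat
  have layer: "(\<Sum>k<2 ^ n. indicator (arc_layer (real k / 2 ^ n) (1 / 2 ^ n) j) z) \<le> 42 * c (n + j)" for n j
  proof -
    have "(\<Sum>k<2 ^ n. indicator (arc_layer (real k / 2 ^ n) (1 / 2 ^ n) j) z) =
       (\<Sum>k\<in>{k. k < 2 ^ n \<and> dist (cis (2 * pi * (real k / 2 ^ n))) z \<le> 16 * (1 / 2 ^ n)}. c (n + j))"
      by (intro sum.mono_neutral_cong_right) (auto simp: arc_layer_def c_def power_add)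
    also have "\<dots> \<le> 42 * c (n + j)"
      using card_dyadic_arcs_near[of n z] by (auto simp: c_def)
    finally show ?thesis .
  qed
  have j: "(\<Sum>(n, k)\<in>P. w n * (1/3) ^ j * indicator (arc_layer (real k / 2 ^ n) (1 / 2 ^ n) j) z) \<le> (2/3) ^ j * (252 * W)" for j
  proof -
    have "(\<Sum>(n, k)\<in>P. w n * (1/3) ^ j * indicator (arc_layer (real k / 2 ^ n) (1 / 2 ^ n) j) z)
       \<le> (\<Sum>(n, k)\<in>Sigma N (\<lambda>n. {..<2 ^ n}). w n * (1/3) ^ j * indicator (arc_layer (real k / 2 ^ n) (1 / 2 ^ n) j) z)"
      using P N w(1) by (intro sum_mono2) (auto simp: N_def image_iff Bex_def)
    also have "\<dots> = (\<Sum>n\<in>N. \<Sum>k<2 ^ n. w n * (1/3) ^ j * indicator (arc_layer (real k / 2 ^ n) (1 / 2 ^ n) j) z)"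
      using N by (intro sum.Sigma[symmetric]) auto
    also have "\<dots> = (\<Sum>n\<in>N. w n * (1/3) ^ j * (\<Sum>k<2 ^ n. indicator (arc_layer (real k / 2 ^ n) (1 / 2 ^ n) j) z))"
      by (simp add: sum_distrib_left)
    also have "\<dots> \<le> (\<Sum>n\<in>N. (2/3) ^ j * (42 * W) * c (n + j))"
    proof (rule sum_mono)
      fix n assume n: "n \<in> N"
      have "w n * (1/3) ^ j * (\<Sum>k<2 ^ n. indicator (arc_layer (real k / 2 ^ n) (1 / 2 ^ n) j) z)
          \<le> (2 ^ j * w (n + j)) * (1/3) ^ j * (42 * c (n + j))"
        using layer w by (intro mult_mono) (auto intro!: sum_nonneg mult_nonneg_nonneg)
      also have "\<dots> = (2/3) ^ j * 42 * (w (n + j) * c (n + j))"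
        by (simp add: power_divide)
      also have "\<dots> \<le> (2/3) ^ j * 42 * (W * c (n + j))"
        using W(2)[of "n + j"] N(2)[OF n] by (intro mult_left_mono) (auto simp: c_def)
      finally show "w n * (1/3) ^ j * (\<Sum>k<2 ^ n. indicator (arc_layer (real k / 2 ^ n) (1 / 2 ^ n) j) z)
          \<le> (2/3) ^ j * (42 * W) * c (n + j)" by simp
    qed
    also have "\<dots> = (2/3) ^ j * (42 * W) * (\<Sum>n\<in>N. c (n + j))" by (simp add: sum_distrib_left)
    also have "\<dots> \<le> (2/3) ^ j * (42 * W) * 6"
    proof (rule mult_left_mono)
      have "(\<Sum>n\<in>N. c (n + j)) = (\<Sum>m\<in>(\<lambda>n. n + j) ` N. c m)"
        by (subst sum.reindex) (auto simp: inj_on_def)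
      also have "\<dots> = (\<Sum>m\<in>{m \<in> (\<lambda>n. n + j) ` N. c m = 1}. 1)"
        using N by (intro sum.mono_neutral_cong_right) (auto simp: c_def)
      also have "\<dots> \<le> 6"
        using card_dyadic_scales[of "{m \<in> (\<lambda>n. n + j) ` N. c m = 1}" "1 - norm z"] N
        by (simp add: c_def split: if_splits)
      finally show "(\<Sum>n\<in>N. c (n + j)) \<le> 6" .
    qed (use W(1) in simp)
    finally show ?thesis by (simp add: mult_ac)
  qed
  have "(\<Sum>(n, k)\<in>P. \<Sum>j. ennreal (w n * (1/3) ^ j * indicator (arc_layer (real k / 2 ^ n) (1 / 2 ^ n) j) z))
      = (\<Sum>j. \<Sum>(n, k)\<in>P. ennreal (w n * (1/3) ^ j * indicator (arc_layer (real k / 2 ^ n) (1 / 2 ^ n) j) z))"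
    unfolding case_prod_beta by (rule suminf_sum[symmetric]) auto
  also have "\<dots> = (\<Sum>j. ennreal (\<Sum>(n, k)\<in>P. w n * (1/3) ^ j * indicator (arc_layer (real k / 2 ^ n) (1 / 2 ^ n) j) z))"
    unfolding case_prod_beta using w(1) by (subst sum_ennreal) auto
  also have "\<dots> \<le> (\<Sum>j. ennreal ((2/3) ^ j * (252 * W)))"
    by (intro suminf_le ennreal_leI j) auto
  also have "\<dots> = ennreal (756 * W)"
  proof (rule suminf_ennreal_eq)
    have "(\<lambda>j. (2/3) ^ j * (252 * W)) sums (1 / (1 - 2/3) * (252 * W))"
      by (intro sums_mult2 geometric_sums) simp
    then show "(\<lambda>j. (2/3) ^ j * (252 * W)) sums (756 * W)" by simp
  qed (use W(1) in auto)
  finally show ?thesis .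
qed

text \<open>The pointwise bound of \<open>arc_layer_overlap\<close> is integrated against |h'|^2,
  sums and integral being interchanged by Tonelli. Only \<open>Q\<close> enters because all layers
  lie in it; this localization is what the Carleson box estimate requires.\<close>

lemma sum_energy_arc_layers_le:
  fixes w :: "nat \<Rightarrow> real"
  assumes h: "h holomorphic_on ball 0 1"
    and P: "finite P" "\<And>n k. (n, k) \<in> P \<Longrightarrow> n0 \<le> n \<and> k < 2 ^ n"
    and w: "\<And>n. 0 \<le> w n" "\<And>n j. w n \<le> 2 ^ j * w (n + j)"
    and Q: "Q \<in> sets borel" "Q \<subseteq> ball 0 1"
      "\<And>n k j. (n, k) \<in> P \<Longrightarrow> arc_layer (real k / 2 ^ n) (1 / 2 ^ n) j \<subseteq> Q"
    and W: "W \<in> borel_measurable borel" "\<And>z. z \<in> Q \<Longrightarrow> 0 \<le> W z"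
      "\<And>m z. z \<in> Q \<Longrightarrow> n0 \<le> m \<Longrightarrow> 1 / 2 ^ m / 4 \<le> 1 - norm z \<Longrightarrow> 1 - norm z \<le> 9 * (1 / 2 ^ m) \<Longrightarrow> w m \<le> W z"
  shows "(\<Sum>(n, k)\<in>P. ennreal (w n) * (\<Sum>j. ennreal ((1/3) ^ j) * energy h (arc_layer (real k / 2 ^ n) (1 / 2 ^ n) j)))
    \<le> 756 * (\<integral>\<^sup>+z\<in>Q. ennreal ((norm (deriv h z))\<^sup>2 * W z) \<partial>lborel)"
proof -
  define g where "g = (\<lambda>z. indicator (ball 0 1) z *\<^sub>R deriv h z)"
  have [measurable]: "g \<in> borel_measurable borel"
    unfolding g_def using holomorphic_on_imp_continuous_on[OF holomorphic_deriv[OF h open_ball]]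
    by (intro borel_measurable_continuous_on_indicator) auto
  note [measurable] = Q(1) W(1)
  have g: "g z = deriv h z" if "z \<in> Q" for z
    using that Q(2) by (auto simp: g_def indicator_def)
  have [measurable]: "arc_layer a l j \<in> sets borel" for a l j
    unfolding arc_layer_def by measurable
  define F where "F n k j z = ennreal (w n * (1/3) ^ j * indicator (arc_layer (real k / 2 ^ n) (1 / 2 ^ n) j) z)" for n k j z
  have [measurable]: "F n k j \<in> borel_measurable borel" for n k j
    unfolding F_def by measurable
  have layer: "ennreal (w n) * (\<Sum>j. ennreal ((1/3) ^ j) * energy h (arc_layer (real k / 2 ^ n) (1 / 2 ^ n) j))
      = (\<integral>\<^sup>+z. (\<Sum>j. ennreal ((norm (g z))\<^sup>2) * F n k j z) \<partial>lborel)" if nk: "(n, k) \<in> P" for n k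
  proof -
    have "energy h (arc_layer (real k / 2 ^ n) (1 / 2 ^ n) j) =
        (\<integral>\<^sup>+z. ennreal ((norm (g z))\<^sup>2) * indicator (arc_layer (real k / 2 ^ n) (1 / 2 ^ n) j) z \<partial>lborel)" for j
      unfolding energy_def using Q(3)[OF nk, of j] g by (intro nn_integral_cong) (auto simp: indicator_def)
    then have "ennreal (w n) * (ennreal ((1/3) ^ j) * energy h (arc_layer (real k / 2 ^ n) (1 / 2 ^ n) j)) =
        (\<integral>\<^sup>+z. ennreal ((norm (g z))\<^sup>2) * F n k j z \<partial>lborel)" for j
      using w(1) by (simp add: F_def ennreal_mult ennreal_indicator mult_ac flip: nn_integral_cmult)
    then have "ennreal (w n) * (\<Sum>j. ennreal ((1/3) ^ j) * energy h (arc_layer (real k / 2 ^ n) (1 / 2 ^ n) j))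
        = (\<Sum>j. \<integral>\<^sup>+z. ennreal ((norm (g z))\<^sup>2) * F n k j z \<partial>lborel)"
      by (simp flip: ennreal_suminf_cmult)
    also have "\<dots> = (\<integral>\<^sup>+z. (\<Sum>j. ennreal ((norm (g z))\<^sup>2) * F n k j z) \<partial>lborel)"
      by (intro nn_integral_suminf[symmetric]) measurable
    finally show ?thesis .
  qed
  have "(\<Sum>(n, k)\<in>P. ennreal (w n) * (\<Sum>j. ennreal ((1/3) ^ j) * energy h (arc_layer (real k / 2 ^ n) (1 / 2 ^ n) j)))
     = (\<Sum>(n, k)\<in>P. \<integral>\<^sup>+z. (\<Sum>j. ennreal ((norm (g z))\<^sup>2) * F n k j z) \<partial>lborel)"
    by (intro sum.cong) (auto simp: layer)
  also have "\<dots> = (\<integral>\<^sup>+z. (\<Sum>(n, k)\<in>P. \<Sum>j. ennreal ((norm (g z))\<^sup>2) * F n k j z) \<partial>lborel)"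
    unfolding case_prod_beta by (intro nn_integral_sum[symmetric]) measurable
  also have "\<dots> = (\<integral>\<^sup>+z. ennreal ((norm (g z))\<^sup>2) * (\<Sum>(n, k)\<in>P. \<Sum>j. F n k j z) \<partial>lborel)"
    by (simp add: case_prod_beta sum_distrib_left)
  also have "\<dots> \<le> (\<integral>\<^sup>+z. 756 * (ennreal ((norm (g z))\<^sup>2 * W z) * indicator Q z) \<partial>lborel)"
  proof (intro nn_integral_mono)
    fix z
    show "ennreal ((norm (g z))\<^sup>2) * (\<Sum>(n, k)\<in>P. \<Sum>j. F n k j z) \<le> 756 * (ennreal ((norm (g z))\<^sup>2 * W z) * indicator Q z)"
    proof (cases "z \<in> Q")
      case True
      have "(\<Sum>(n, k)\<in>P. \<Sum>j. F n k j z) \<le> ennreal (756 * W z)"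
        unfolding F_def by (rule arc_layer_overlap[OF P w]) (use W True in auto)
      then have "ennreal ((norm (g z))\<^sup>2) * (\<Sum>(n, k)\<in>P. \<Sum>j. F n k j z) \<le> ennreal ((norm (g z))\<^sup>2) * ennreal (756 * W z)"
        by (rule mult_left_mono) simp
      also have "\<dots> = 756 * ennreal ((norm (g z))\<^sup>2 * W z)"
        using W(2)[OF True] by (simp add: ennreal_mult mult_ac)
      finally show ?thesis using True by simp
    next
      case False
      have "(\<Sum>j. F n k j z) = 0" if "(n, k) \<in> P" for n k
      proof -
        have "z \<notin> arc_layer (real k / 2 ^ n) (1 / 2 ^ n) j" for j using Q(3)[OF that] False by blast
        then show ?thesis by (simp add: F_def)
      qed
      then have "(\<Sum>(n, k)\<in>P. \<Sum>j. F n k j z) = 0" by (intro sum.neutral) auto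
      then show ?thesis by simp
    qed
  qed
  also have "\<dots> = 756 * (\<integral>\<^sup>+z\<in>Q. ennreal ((norm (g z))\<^sup>2 * W z) \<partial>lborel)"
    by (rule nn_integral_cmult) measurable
  also have "(\<integral>\<^sup>+z\<in>Q. ennreal ((norm (g z))\<^sup>2 * W z) \<partial>lborel) = (\<integral>\<^sup>+z\<in>Q. ennreal ((norm (deriv h z))\<^sup>2 * W z) \<partial>lborel)"
    by (intro nn_integral_cong) (auto simp: indicator_def g)
  finally show ?thesis .
qed

text \<open>The energy terms of \<open>beta_square_le_energy\<close> are covered by the overlap
  bound. The curvature term 4^-n occurs at most 2^n times at scale n, so these terms contribute at
  most w(n) / 2^n per scale, whence \<open>B\<close>.\<close>

lemma sum_beta_square_le:
  fixes w :: "nat \<Rightarrow> real"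
  assumes f: "f holomorphic_on ball 0 1" and fc: "continuous_on (cball 0 1) f"
    and h: "log_deriv_branch f h" and n0: "1 \<le> n0"
    and small: "\<And>x r. norm x = 1 \<Longrightarrow> 0 < r \<Longrightarrow> r \<le> 1 / 2 ^ n0 \<Longrightarrow> energy h (boundary_box x r) \<le> ennreal (1 / 31360000)"
    and P: "finite P" "\<And>n k. (n, k) \<in> P \<Longrightarrow> n0 \<le> n \<and> k < 2 ^ n"
    and w: "\<And>n. 0 \<le> w n" "\<And>n j. w n \<le> 2 ^ j * w (n + j)"
    and B: "\<And>N. finite N \<Longrightarrow> N \<subseteq> {n0..} \<Longrightarrow> (\<Sum>n\<in>N. w n / 2 ^ n) \<le> B"
    and Q: "Q \<in> sets borel" "Q \<subseteq> ball 0 1"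
      "\<And>n k j. (n, k) \<in> P \<Longrightarrow> arc_layer (real k / 2 ^ n) (1 / 2 ^ n) j \<subseteq> Q"
    and W: "W \<in> borel_measurable borel" "\<And>z. z \<in> Q \<Longrightarrow> 0 \<le> W z"
      "\<And>m z. z \<in> Q \<Longrightarrow> n0 \<le> m \<Longrightarrow> 1 / 2 ^ m / 4 \<le> 1 - norm z \<Longrightarrow> 1 - norm z \<le> 9 * (1 / 2 ^ m) \<Longrightarrow> w m \<le> W z"
  shows "(\<Sum>(n, k)\<in>P. ennreal ((beta (f \<circ> arc_path (dyadic_arc (n, k))))\<^sup>2 * w n))
    \<le> ennreal (10 ^ 7) * (ennreal B + 756 * (\<integral>\<^sup>+z\<in>Q. ennreal ((norm (deriv h z))\<^sup>2 * W z) \<partial>lborel))"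
proof -
  have h': "h holomorphic_on ball 0 1" using h by (simp add: log_deriv_branch_def)
  let ?E = "\<lambda>n k. \<Sum>j. ennreal ((1/3) ^ j) * energy h (arc_layer (real k / 2 ^ n) (1 / 2 ^ n) j)"
  define N where "N = fst ` P"
  have N: "finite N" "N \<subseteq> {n0..}" using P by (auto simp: N_def)
  have "(\<Sum>(n, k)\<in>P. ennreal ((beta (f \<circ> arc_path (dyadic_arc (n, k))))\<^sup>2 * w n))
      \<le> (\<Sum>(n, k)\<in>P. ennreal (10 ^ 7) * (ennreal (w n * (1 / 2 ^ n)\<^sup>2) + ennreal (w n) * ?E n k))"
  proof (intro sum_mono, clarify)
    fix n k assume nk: "(n, k) \<in> P"
    have n: "n0 \<le> n" using P(2)[OF nk] by simp
    have l: "0 < (1 / 2 ^ n :: real)" "(1 / 2 ^ n :: real) \<le> 1 / 2 ^ n0" "(1 / 2 ^ n0 :: real) \<le> 1 / 2 ^ 1"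
      using n power_increasing[OF n0, of "2::real"] by (auto simp: power_increasing divide_left_mono)
    have "ennreal ((beta (f \<circ> arc_path (dyadic_arc (n, k))))\<^sup>2)
        \<le> ennreal (10 ^ 7) * (ennreal ((1 / 2 ^ n)\<^sup>2) + ?E n k)"
      unfolding dyadic_arc_def prod.case
      by (rule beta_square_le_energy[OF f fc h]) (use l order_trans[OF l(2,3)] small in auto)
    then have "ennreal (w n) * ennreal ((beta (f \<circ> arc_path (dyadic_arc (n, k))))\<^sup>2)
        \<le> ennreal (w n) * (ennreal (10 ^ 7) * (ennreal ((1 / 2 ^ n)\<^sup>2) + ?E n k))"
      by (rule mult_left_mono) simp
    also have "\<dots> = ennreal (10 ^ 7) * (ennreal (w n * (1 / 2 ^ n)\<^sup>2) + ennreal (w n) * ?E n k)"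
      using w(1)[of n] by (simp add: ennreal_mult distrib_left mult.left_commute)
    also have "ennreal (w n) * ennreal ((beta (f \<circ> arc_path (dyadic_arc (n, k))))\<^sup>2) =
        ennreal ((beta (f \<circ> arc_path (dyadic_arc (n, k))))\<^sup>2 * w n)"
      using w(1)[of n] by (simp add: ennreal_mult mult.commute)
    finally show "ennreal ((beta (f \<circ> arc_path (dyadic_arc (n, k))))\<^sup>2 * w n)
        \<le> ennreal (10 ^ 7) * (ennreal (w n * (1 / 2 ^ n)\<^sup>2) + ennreal (w n) * ?E n k)" .
  qed
  also have "\<dots> = ennreal (10 ^ 7) * ((\<Sum>(n, k)\<in>P. ennreal (w n * (1 / 2 ^ n)\<^sup>2)) + (\<Sum>(n, k)\<in>P. ennreal (w n) * ?E n k))"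
    by (simp add: case_prod_beta sum_distrib_left sum.distrib distrib_left)
  also have "\<dots> \<le> ennreal (10 ^ 7) * (ennreal B + 756 * (\<integral>\<^sup>+z\<in>Q. ennreal ((norm (deriv h z))\<^sup>2 * W z) \<partial>lborel))"
  proof (intro mult_left_mono add_mono sum_energy_arc_layers_le[OF h' P w Q W])
    have "(\<Sum>(n, k)\<in>P. w n * (1 / 2 ^ n)\<^sup>2) \<le> (\<Sum>(n, k)\<in>Sigma N (\<lambda>n. {..<(2::nat) ^ n}). w n * (1 / 2 ^ n)\<^sup>2)"
      using P N w(1) by (intro sum_mono2) (auto simp: N_def image_iff Bex_def)
    also have "\<dots> = (\<Sum>n\<in>N. \<Sum>k<(2::nat) ^ n. w n * (1 / 2 ^ n)\<^sup>2)"
      using N by (intro sum.Sigma[symmetric]) auto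
    also have "\<dots> = (\<Sum>n\<in>N. w n / 2 ^ n)"
      by (intro sum.cong) (auto simp: power2_eq_square)
    also have "\<dots> \<le> B" using B N by simp
    finally have "ennreal (\<Sum>(n, k)\<in>P. w n * (1 / 2 ^ n)\<^sup>2) \<le> ennreal B" by (rule ennreal_leI)
    moreover have "ennreal (\<Sum>(n, k)\<in>P. w n * (1 / 2 ^ n)\<^sup>2) = (\<Sum>(n, k)\<in>P. ennreal (w n * (1 / 2 ^ n)\<^sup>2))"
      unfolding case_prod_beta using w(1) by (intro sum_ennreal[symmetric]) auto
    ultimately show "(\<Sum>(n, k)\<in>P. ennreal (w n * (1 / 2 ^ n)\<^sup>2)) \<le> ennreal B" by simp
  qed auto
  finally show ?thesis .
qed

subsection \<open>Carleson boxes\<close>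

lemma carleson_box_subset_ball: "carleson_box I \<subseteq> ball 0 1"
  by (auto simp: carleson_box_def)

lemma borel_carleson_box [measurable]: "carleson_box I \<in> sets borel"
proof -
  have "closed (arc_set I)"
    unfolding arc_set_def arc_path_def by (intro closed_path_image) simp
  then have [measurable]: "arc_set I \<in> sets borel" by simp
  show ?thesis unfolding carleson_box_def by measurable
qed

text \<open>The radial projection of z moves it by 1 - |z| \<le> R, hence lies within 2 R of the
  centre of the arc. The chord estimate turns this into an angular distance of at most 2 R /
  3.\<close>

lemma mem_carleson_box:
  assumes z: "norm z < 1" and d: "dist (cis (2 * pi * a)) z \<le> R" and R: "R \<le> 1 / 2"
  shows "z \<in> carleson_box (a - R, 2 * R)"
proof -
  have nz: "1 - norm z \<le> R" using d norm_triangle_ineq2[of "cis (2 * pi * a)" z] by (simp add: dist_norm)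
  then have z0: "z \<noteq> 0" and R0: "0 < R" using R z by auto
  define y where "y = z / of_real (norm z)"
  have y: "norm y = 1" using z0 by (simp add: y_def norm_divide)
  have "z - y = of_real (norm z - 1) * y" using z0 by (simp add: y_def field_simps)
  then have "norm (z - y) = \<bar>norm z - 1\<bar> * norm y" by (simp only: norm_mult norm_of_real)
  then have zy: "norm (z - y) = 1 - norm z" using y z by simp
  then have yx: "norm (y - cis (2 * pi * a)) \<le> 2 * R"
    using zy nz d norm_triangle_ineq4[of "z - cis (2 * pi * a)" "z - y"] by (simp add: dist_norm norm_minus_commute)
  \<comment> \<open>The principal argument relative to \<open>a\<close> keeps \<open>t\<close>
    within half a turn, as the chord estimate demands.\<close>
  define t where "t = Arg (y * cis (- (2 * pi * a))) / (2 * pi)"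
  have "norm (y * cis (- (2 * pi * a))) = 1" using y by (simp add: norm_mult)
  then have "cis (2 * pi * t) = y * cis (- (2 * pi * a))"
    using rcis_cmod_Arg[of "y * cis (- (2 * pi * a))"] by (simp add: t_def rcis_def)
  then have "cis (2 * pi * a) * cis (2 * pi * t) = y"
    by (simp add: cis_mult mult.assoc mult.commute[of "cis (2 * pi * a)"])
  then have ty: "cis (2 * pi * (a + t)) = y" by (simp add: cis_mult distrib_left)
  have t: "\<bar>t\<bar> \<le> 1 / 2"
    using Arg_bounded[of "y * cis (- (2 * pi * a))"] by (auto simp: t_def abs_le_iff field_simps)
  then have "3 * \<bar>t\<bar> \<le> norm (y - cis (2 * pi * a))"
    using norm_cis_diff_ge[of "a + t" a] ty by simp
  then have "\<bar>t\<bar> \<le> R" using yx R0 by simp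
  then have "y \<in> arc_set (a - R, 2 * R)"
    unfolding arc_set_eq[of "2 * R" "a - R", OF less_imp_le, OF mult_pos_pos, OF zero_less_numeral R0] using ty
    by (intro CollectI exI[of _ "a + t"]) auto
  then show ?thesis using z nz R0 by (simp add: carleson_box_def arc_length_def y_def)
qed

text \<open>Inclusion is known only for sets, so lengths are recovered from endpoints. The endpoints
  of the smaller arc have parameters u and v in the larger one. Up to a half circle the chord 2
  sin(pi t) is increasing in t, which gives l \<le> |v - u| \<le> m.\<close>

lemma arc_set_subset_imp:
  assumes sub: "arc_set (a, l) \<subseteq> arc_set (b, m)" and l: "0 < l" "l \<le> 1 / 2" and m: "0 < m" "m \<le> 1 / 2"
  shows "l \<le> m" "dist (cis (2 * pi * b)) (cis (2 * pi * a)) \<le> 7 * m"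
proof -
  have "cis (2 * pi * a) \<in> arc_set (a, l)" "cis (2 * pi * (a + l)) \<in> arc_set (a, l)"
    using l by (subst arc_set_eq; force)+
  then have "cis (2 * pi * a) \<in> arc_set (b, m)" "cis (2 * pi * (a + l)) \<in> arc_set (b, m)"
    using sub by blast+
  then obtain u v where u: "cis (2 * pi * a) = cis (2 * pi * u)" "b \<le> u" "u \<le> b + m"
    and v: "cis (2 * pi * (a + l)) = cis (2 * pi * v)" "b \<le> v" "v \<le> b + m"
    using m by (auto simp: arc_set_eq)
  show "dist (cis (2 * pi * b)) (cis (2 * pi * a)) \<le> 7 * m"
    using norm_cis_diff_le[of b u] u by (simp add: dist_norm)
  have chord: "norm (cis (2 * pi * s) - cis (2 * pi * t)) = 2 * sin (pi * \<bar>s - t\<bar>)" if "\<bar>s - t\<bar> \<le> 1 / 2" for s t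
  proof -
    have "\<bar>sin (pi * r)\<bar> = sin (pi * \<bar>r\<bar>)" if "\<bar>r\<bar> \<le> 1 / 2" for r
    proof -
      have "\<bar>sin (pi * r)\<bar> = \<bar>sin (pi * \<bar>r\<bar>)\<bar>" by (cases "0 \<le> r") auto
      moreover have "pi * \<bar>r\<bar> \<le> pi * 1" using that by (intro mult_left_mono) auto
      then have "0 \<le> sin (pi * \<bar>r\<bar>)" by (intro sin_ge_zero) auto
      ultimately show ?thesis by simp
    qed
    from this[OF that] show ?thesis
      unfolding norm_cis_diff by (simp add: right_diff_distrib[symmetric] mult.assoc)
  qed
  have uv: "\<bar>v - u\<bar> \<le> m" using u v by auto
  have "sin (pi * l) = sin (pi * \<bar>v - u\<bar>)"
    using chord[of "a + l" a] chord[of v u] u v uv l m by simp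
  then have "pi * l \<le> pi * \<bar>v - u\<bar>"
    using sin_mono_le_eq[of "pi * l" "pi * \<bar>v - u\<bar>"] l m uv pi_gt_zero
      mult_left_mono[of l "1/2" pi] mult_left_mono[of "\<bar>v - u\<bar>" "1/2" pi]
      mult_nonneg_nonneg[of pi l] mult_nonneg_nonneg[of pi "\<bar>v - u\<bar>"]
    by linarith
  then show "l \<le> m" using uv by simp
qed

section \<open>Measurability and scaling of weighted energy integrals\<close>

lemma borel_measurable_deriv_weight:
  assumes h: "h holomorphic_on ball 0 1" and Q: "Q \<in> sets borel" "Q \<subseteq> ball 0 1"
    and [measurable]: "W \<in> borel_measurable borel"
  shows "(\<lambda>z. ennreal ((norm (deriv h z))\<^sup>2 * W z) * indicator Q z) \<in> borel_measurable borel"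
proof -
  note [measurable] = Q(1)
  define g where "g = (\<lambda>z. indicator (ball 0 1) z *\<^sub>R deriv h z)"
  have [measurable]: "g \<in> borel_measurable borel"
    unfolding g_def using holomorphic_on_imp_continuous_on[OF holomorphic_deriv[OF h open_ball]]
    by (intro borel_measurable_continuous_on_indicator) auto
  have "(\<lambda>z. ennreal ((norm (g z))\<^sup>2 * W z) * indicator Q z) \<in> borel_measurable borel" by measurable
  also have "(\<lambda>z. ennreal ((norm (g z))\<^sup>2 * W z) * indicator Q z) = (\<lambda>z. ennreal ((norm (deriv h z))\<^sup>2 * W z) * indicator Q z)"
    using Q(2) by (auto simp: fun_eq_iff g_def indicator_def)
  finally show ?thesis .
qed

lemma nn_integral_deriv_weight_cmult:
  assumes h: "h holomorphic_on ball 0 1" and Q: "Q \<in> sets borel" "Q \<subseteq> ball 0 1"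
    and W: "W \<in> borel_measurable borel" and c: "0 \<le> c"
  shows "(\<integral>\<^sup>+z\<in>Q. ennreal ((norm (deriv h z))\<^sup>2 * (c * W z)) \<partial>lborel)
     = ennreal c * (\<integral>\<^sup>+z\<in>Q. ennreal ((norm (deriv h z))\<^sup>2 * W z) \<partial>lborel)"
proof -
  have "ennreal c * (\<integral>\<^sup>+z\<in>Q. ennreal ((norm (deriv h z))\<^sup>2 * W z) \<partial>lborel)
      = (\<integral>\<^sup>+z. ennreal c * (ennreal ((norm (deriv h z))\<^sup>2 * W z) * indicator Q z) \<partial>lborel)"
    using borel_measurable_deriv_weight[OF h Q W] by (intro nn_integral_cmult[symmetric]) simp
  also have "\<dots> = (\<integral>\<^sup>+z\<in>Q. ennreal ((norm (deriv h z))\<^sup>2 * (c * W z)) \<partial>lborel)"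
  proof (intro nn_integral_cong)
    fix z
    have "ennreal ((norm (deriv h z))\<^sup>2 * (c * W z)) = ennreal c * ennreal ((norm (deriv h z))\<^sup>2 * W z)"
      unfolding ennreal_mult'[OF c, symmetric] by (simp add: mult.left_commute)
    then show "ennreal c * (ennreal ((norm (deriv h z))\<^sup>2 * W z) * indicator Q z)
        = ennreal ((norm (deriv h z))\<^sup>2 * (c * W z)) * indicator Q z"
      by (simp add: mult.assoc)
  qed
  finally show ?thesis ..
qed

section \<open>Energy and beta sums in Carleson boxes\<close>

lemma boundary_box_subset_carleson_box:
  assumes "0 < r" "9 * r \<le> 1 / 2"
  shows "boundary_box (cis (2 * pi * a)) r \<subseteq> carleson_box (a - 9 * r, 2 * (9 * r))"
proof
  fix z assume "z \<in> boundary_box (cis (2 * pi * a)) r"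
  then show "z \<in> carleson_box (a - 9 * r, 2 * (9 * r))"
    using assms by (intro mem_carleson_box) (auto simp: boundary_box_def)
qed

lemma one_minus_norm_le: "norm z \<le> 1 \<Longrightarrow> 1 - norm z \<le> 1 - (norm z)\<^sup>2"
  by (simp add: power2_eq_square mult_left_le)

text \<open>The boundary box lies in a Carleson box of length 18 r, and on it 1 - |z|^2 \<ge> r/4.
  There the weight is comparable to the p-th power of the length, with constant (4 * 18)^p \<le>
  72.\<close>

lemma Q_p0_energy_small:
  assumes p: "0 < p" "p \<le> 1" and h: "h holomorphic_on ball 0 1"
    and e: "0 < e"
    and box: "\<And>I. I \<in> circle_arcs \<Longrightarrow> arc_length I \<le> \<delta> \<Longrightarrow> ennreal (1 / arc_length I powr p) *
         (\<integral>\<^sup>+z\<in>carleson_box I. ennreal ((norm (deriv h z))\<^sup>2 * (1 - (norm z)\<^sup>2) powr p) \<partial>lborel) \<le> ennreal e"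
    and x: "norm x = 1" and r: "0 < r" "18 * r \<le> \<delta>" "18 * r \<le> 1"
  shows "energy h (boundary_box x r) \<le> ennreal (72 * e)"
proof -
  obtain a where a: "x = cis (2 * pi * a)"
  proof
    show "x = cis (2 * pi * (Arg x / (2 * pi)))" using rcis_cmod_Arg[of x] x by (simp add: rcis_def)
  qed
  let ?I = "(a - 9 * r, 2 * (9 * r))"
  let ?W = "\<lambda>z. (1 - (norm z)\<^sup>2) powr p"
  have sub: "boundary_box x r \<subseteq> carleson_box ?I"
    unfolding a using r by (intro boundary_box_subset_carleson_box) auto
  have "energy h (boundary_box x r) \<le> (\<integral>\<^sup>+z\<in>carleson_box ?I. ennreal ((norm (deriv h z))\<^sup>2 * ((4 / r) powr p * ?W z)) \<partial>lborel)"
    unfolding energy_def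
  proof (intro nn_integral_mono)
    fix z
    show "ennreal ((norm (deriv h z))\<^sup>2) * indicator (boundary_box x r) z \<le>
        ennreal ((norm (deriv h z))\<^sup>2 * ((4 / r) powr p * ?W z)) * indicator (carleson_box ?I) z"
    proof (cases "z \<in> boundary_box x r")
      case True
      then have zQ: "z \<in> carleson_box ?I" and d: "r / 4 \<le> 1 - norm z" using sub by (auto simp: boundary_box_def)
      have "r / 4 \<le> 1 - (norm z)\<^sup>2" using d one_minus_norm_le[of z] r by auto
      then have "1 \<le> 4 / r * (1 - (norm z)\<^sup>2)" using r by (simp add: field_simps)
      then have "1 \<le> (4 / r * (1 - (norm z)\<^sup>2)) powr p" using p by (intro ge_one_powr_ge_zero) auto
      also have "\<dots> = (4 / r) powr p * ?W z" using r by (intro powr_mult)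
      finally have "(norm (deriv h z))\<^sup>2 * 1 \<le> (norm (deriv h z))\<^sup>2 * ((4 / r) powr p * ?W z)"
        by (intro mult_left_mono) auto
      then show ?thesis using True zQ by (simp add: ennreal_leI)
    qed simp
  qed
  also have "\<dots> = ennreal ((4 / r) powr p) * (\<integral>\<^sup>+z\<in>carleson_box ?I. ennreal ((norm (deriv h z))\<^sup>2 * ?W z) \<partial>lborel)"
    by (intro nn_integral_deriv_weight_cmult h carleson_box_subset_ball borel_carleson_box) auto
  also have "ennreal ((4 / r) powr p) = ennreal (72 powr p) * ennreal (1 / arc_length ?I powr p)"
  proof -
    have "4 / r = 72 * (1 / (18 * r))" by simp
    then have "(4 / r) powr p = 72 powr p * (1 / (18 * r)) powr p" by (simp only: powr_mult)
    also have "(1 / (18 * r)) powr p = 1 / (18 * r) powr p" using r by (subst powr_divide) auto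
    finally show ?thesis by (simp add: arc_length_def flip: ennreal_mult')
  qed
  also have "\<dots> * (\<integral>\<^sup>+z\<in>carleson_box ?I. ennreal ((norm (deriv h z))\<^sup>2 * ?W z) \<partial>lborel) \<le> ennreal 72 * ennreal e"
    unfolding mult.assoc
  proof (intro mult_mono box)
    show "ennreal (72 powr p) \<le> ennreal 72" using p powr_mono[of p 1 72] by (intro ennreal_leI) simp
  qed (use r in \<open>auto simp: circle_arcs_def arc_length_def\<close>)
  also have "\<dots> = ennreal (72 * e)" using e by (simp add: ennreal_mult)
  finally show ?thesis .
qed

lemma arc_layer_subset_carleson_box:
  assumes d: "dist (cis (2 * pi * b)) (cis (2 * pi * a)) \<le> 7 * m" and l: "0 < l" "l \<le> m" and m: "48 * m \<le> 1"
  shows "arc_layer a l j \<subseteq> carleson_box (b - 24 * m, 2 * (24 * m))"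
proof
  fix z assume z: "z \<in> arc_layer a l j"
  have "0 < l / 2 ^ j / 4" using l by simp
  then have "norm z < 1" using z by (auto simp: arc_layer_def)
  moreover have "dist (cis (2 * pi * b)) z \<le> 24 * m"
    using z d l dist_triangle[of "cis (2 * pi * b)" z "cis (2 * pi * a)"] by (auto simp: arc_layer_def)
  ultimately show "z \<in> carleson_box (b - 24 * m, 2 * (24 * m))"
    using m by (intro mem_carleson_box) auto
qed

lemma sum_inverse_powers_le:
  assumes "finite N" "N \<subseteq> {n0..}"
  shows "(\<Sum>n\<in>N. 1 / 2 ^ n :: real) \<le> 2 / 2 ^ n0"
proof -
  have "(\<Sum>n\<in>N. 1 / 2 ^ n :: real) \<le> (\<Sum>n\<in>{n0..<n0 + Suc (Max (insert 0 N))}. 1 / 2 ^ n)"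
  proof (intro sum_mono2)
    show "N \<subseteq> {n0..<n0 + Suc (Max (insert 0 N))}"
    proof
      fix n assume "n \<in> N"
      then have "n \<le> Max (insert 0 N)" "n0 \<le> n" using assms by (auto intro: Max_ge)
      then show "n \<in> {n0..<n0 + Suc (Max (insert 0 N))}" by simp
    qed
  qed auto
  also have "\<dots> = (\<Sum>i<Suc (Max (insert 0 N)). 1 / 2 ^ n0 * (1/2) ^ i)"
    by (subst sum.atLeastLessThan_shift_0) (simp add: power_add power_divide lessThan_atLeast0)
  also have "\<dots> = 1 / 2 ^ n0 * (\<Sum>i<Suc (Max (insert 0 N)). (1/2) ^ i)"
    by (simp only: sum_distrib_left)
  also have "\<dots> \<le> 1 / 2 ^ n0 * 2"
  proof (rule mult_left_mono)
    show "(\<Sum>i<Suc (Max (insert 0 N)). (1/2 :: real) ^ i) \<le> 2"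
      by (subst sum_gp_strict) (simp del: power_Suc)
  qed simp
  finally show ?thesis by simp
qed

text \<open>The weights are w(n) = |I|^p. All layers of arcs inside J lie in the Carleson box of
  length 48 |J| centred at the start of J, to which the hypothesis on boxes applies. Both parts of
  the bound carry the factor |J|^p, which the normalization removes. The constant is 756 * 4 * 48 =
  145152.\<close>

lemma Q_p0_beta_sum_le:
  assumes f: "f holomorphic_on ball 0 1" and fc: "continuous_on (cball 0 1) f"
    and h: "log_deriv_branch f h" and p: "0 < p" "p \<le> 1"
    and e: "0 < e" "e \<le> 1 / 10 ^ 10"
    and box: "\<And>I. I \<in> circle_arcs \<Longrightarrow> arc_length I \<le> \<delta> \<Longrightarrow> ennreal (1 / arc_length I powr p) *
         (\<integral>\<^sup>+z\<in>carleson_box I. ennreal ((norm (deriv h z))\<^sup>2 * (1 - (norm z)\<^sup>2) powr p) \<partial>lborel) \<le> ennreal e"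
    and J: "J \<in> dyadic_arcs" "48 * arc_length J \<le> \<delta>" "48 * arc_length J \<le> 1"
  shows "ennreal (1 / arc_length J powr p) *
      (\<Sum>\<^sub>\<infinity>I\<in>{I \<in> dyadic_arcs. arc_set I \<subseteq> arc_set J}. ennreal ((beta (f \<circ> arc_path I))\<^sup>2 * arc_length I powr p))
     \<le> ennreal (10 ^ 7 * (2 * arc_length J + 145152 * e))"
proof -
  have h': "h holomorphic_on ball 0 1" using h by (simp add: log_deriv_branch_def)
  obtain n0 k0 where J_eq: "J = dyadic_arc (n0, k0)" and n0: "1 \<le> n0" and k0: "k0 < 2 ^ n0"
    using J(1) by (auto simp: dyadic_arcs_eq)
  define l where "l = (1 / 2 ^ n0 :: real)"
  have Jl: "arc_length J = l" by (simp add: J_eq dyadic_arc_def arc_length_def l_def)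
  have l: "0 < l" "48 * l \<le> \<delta>" "48 * l \<le> 1" using J Jl by (auto simp: l_def)
  define b where "b = real k0 / 2 ^ n0"
  define Q where "Q = carleson_box (b - 24 * l, 2 * (24 * l))"
  define V where "V = (\<lambda>z::complex. (1 - (norm z)\<^sup>2) powr p)"
  have V [measurable]: "V \<in> borel_measurable borel" unfolding V_def by measurable
  define w where "w n = (1 / 2 ^ n :: real) powr p" for n :: nat
  have w0: "0 \<le> w n" for n by (simp add: w_def)
  \<comment> \<open>The growth per scale is 2^p, and p \<le> 1 makes it at most doubling.\<close>
  have w1: "w n \<le> 2 ^ j * w (n + j)" for n j
  proof -
    have "w n = (2 ^ j * (1 / 2 ^ (n + j))) powr p" by (simp add: w_def power_add)
    also have "\<dots> = (2 ^ j) powr p * w (n + j)" by (simp only: w_def powr_mult)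
    also have "\<dots> \<le> 2 ^ j * w (n + j)"
      using p powr_mono[of p 1 "2 ^ j"] w0 by (intro mult_right_mono) auto
    finally show ?thesis .
  qed
  have w_anti: "w n \<le> w n0" if "n0 \<le> n" for n
    unfolding w_def using that p by (intro powr_mono2) (auto intro!: divide_left_mono power_increasing)
  have B: "(\<Sum>n\<in>N. w n / 2 ^ n) \<le> w n0 * (2 * l)" if "finite N" "N \<subseteq> {n0..}" for N
  proof -
    have "(\<Sum>n\<in>N. w n / 2 ^ n) \<le> (\<Sum>n\<in>N. w n0 * (1 / 2 ^ n))"
      using that w_anti by (intro sum_mono) (auto simp: divide_right_mono)
    also have "\<dots> = w n0 * (\<Sum>n\<in>N. 1 / 2 ^ n)" by (rule sum_distrib_left[symmetric])
    also have "\<dots> \<le> w n0 * (2 / 2 ^ n0)"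
      using sum_inverse_powers_le[OF that] w0 by (rule mult_left_mono)
    finally show ?thesis by (simp add: l_def)
  qed
  have W: "w m \<le> 4 * V z" if "1 / 2 ^ m / 4 \<le> 1 - norm z" for m and z :: complex
  proof -
    have pos: "0 < (1 / 2 ^ m / 4 :: real)" by simp
    have "norm z < 1" using that pos by linarith
    then have "1 / 2 ^ m / 4 \<le> 1 - (norm z)\<^sup>2" using that one_minus_norm_le[of z] by linarith
    then have "w m \<le> (4 * (1 - (norm z)\<^sup>2)) powr p"
      unfolding w_def using p by (intro powr_mono2) auto
    also have "\<dots> = 4 powr p * V z" by (simp only: V_def powr_mult)
    also have "\<dots> \<le> 4 * V z"
      using p powr_mono[of p 1 4] by (intro mult_right_mono) (auto simp: V_def)
    finally show ?thesis .
  qed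
  have small: "energy h (boundary_box x r) \<le> ennreal (1 / 31360000)"
    if "norm x = 1" "0 < r" "r \<le> 1 / 2 ^ n0" for x r
  proof -
    have "r \<le> l" using that by (simp add: l_def)
    then have "energy h (boundary_box x r) \<le> ennreal (72 * e)"
      using l that by (intro Q_p0_energy_small[OF p h' e(1) box]) auto
    \<comment> \<open>Here \<open>e \<le> 1 / 10 ^ 10\<close> is what makes 72 e small
      enough.\<close>
    also have "\<dots> \<le> ennreal (1 / 31360000)" using e by (intro ennreal_leI) simp
    finally show ?thesis .
  qed
  have Int: "(\<integral>\<^sup>+z\<in>Q. ennreal ((norm (deriv h z))\<^sup>2 * (4 * V z)) \<partial>lborel) \<le> ennreal (w n0 * (192 * e))"
  proof -
    have wp: "0 < w n0" by (simp add: w_def)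
    have "ennreal (1 / arc_length (b - 24 * l, 2 * (24 * l)) powr p) *
         (\<integral>\<^sup>+z\<in>Q. ennreal ((norm (deriv h z))\<^sup>2 * V z) \<partial>lborel) \<le> ennreal e"
      unfolding Q_def V_def using l by (intro box) (auto simp: circle_arcs_def arc_length_def)
    then have "ennreal ((48 * l) powr p) * (ennreal (1 / (48 * l) powr p) * (\<integral>\<^sup>+z\<in>Q. ennreal ((norm (deriv h z))\<^sup>2 * V z) \<partial>lborel))
        \<le> ennreal ((48 * l) powr p) * ennreal e"
      by (intro mult_left_mono) (auto simp: arc_length_def)
    moreover have "ennreal ((48 * l) powr p) * (ennreal (1 / (48 * l) powr p) * X) = X" for X
      unfolding mult.assoc[symmetric] using l by (subst ennreal_mult'[symmetric]) auto
    ultimately have "(\<integral>\<^sup>+z\<in>Q. ennreal ((norm (deriv h z))\<^sup>2 * V z) \<partial>lborel) \<le> ennreal ((48 * l) powr p * e)"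
      using e by (simp add: ennreal_mult)
    also have "(48 * l) powr p * e = 48 powr p * w n0 * e" by (simp only: powr_mult w_def l_def)
    also have "\<dots> \<le> 48 * w n0 * e"
      using p powr_mono[of p 1 48] wp e by (intro mult_right_mono) auto
    finally have le: "(\<integral>\<^sup>+z\<in>Q. ennreal ((norm (deriv h z))\<^sup>2 * V z) \<partial>lborel) \<le> ennreal (48 * w n0 * e)"
      by (simp add: ennreal_leI)
    have "(\<integral>\<^sup>+z\<in>Q. ennreal ((norm (deriv h z))\<^sup>2 * (4 * V z)) \<partial>lborel)
        = ennreal 4 * (\<integral>\<^sup>+z\<in>Q. ennreal ((norm (deriv h z))\<^sup>2 * V z) \<partial>lborel)"
      unfolding Q_def by (intro nn_integral_deriv_weight_cmult h' carleson_box_subset_ball borel_carleson_box V) simp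
    also have "\<dots> \<le> ennreal 4 * ennreal (48 * w n0 * e)" by (intro mult_left_mono le) simp
    also have "\<dots> = ennreal (4 * (48 * w n0 * e))" using wp e by (intro ennreal_mult[symmetric]) auto
    finally show ?thesis by (simp add: mult_ac)
  qed
  \<comment> \<open>For nonnegative extended reals a bound on all finite partial sums bounds the
    infinite sum.\<close>
  have fin: "sum (\<lambda>I. ennreal ((beta (f \<circ> arc_path I))\<^sup>2 * arc_length I powr p)) F
      \<le> ennreal (w n0 * (10 ^ 7 * (2 * l + 145152 * e)))"
    if F: "finite F" "F \<subseteq> {I \<in> dyadic_arcs. arc_set I \<subseteq> arc_set J}" for F
  proof -
    obtain P where P: "P \<subseteq> {(n, k). 1 \<le> n \<and> k < 2 ^ n}" "finite P" "F = dyadic_arc ` P"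
      using finite_subset_image[OF F(1), of dyadic_arc "{(n, k). 1 \<le> n \<and> k < 2 ^ n}"] F(2) dyadic_arcs_eq by blast
    have nk: "n0 \<le> n \<and> k < 2 ^ n \<and> (\<forall>j. arc_layer (real k / 2 ^ n) (1 / 2 ^ n) j \<subseteq> Q)" if "(n, k) \<in> P" for n k
    proof -
      have sub: "arc_set (real k / 2 ^ n, 1 / 2 ^ n) \<subseteq> arc_set (b, l)"
        using that F(2) P(3) by (auto simp: J_eq dyadic_arc_def b_def l_def)
      have "1 \<le> n" "k < 2 ^ n" using that P(1) by auto
      then have hl: "0 < (1 / 2 ^ n :: real)" "(1 / 2 ^ n :: real) \<le> 1 / 2"
        using power_increasing[of 1 n "2::real"] by auto
      note s = arc_set_subset_imp[OF sub hl l(1)]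
      have le: "1 / 2 ^ n \<le> l" "dist (cis (2 * pi * b)) (cis (2 * pi * (real k / 2 ^ n))) \<le> 7 * l"
        using s l by auto
      then have "n0 \<le> n" by (simp add: l_def divide_simps)
      moreover have "arc_layer (real k / 2 ^ n) (1 / 2 ^ n) j \<subseteq> Q" for j
        unfolding Q_def by (rule arc_layer_subset_carleson_box[OF le(2) hl(1) le(1) l(3)])
      ultimately show ?thesis using \<open>k < 2 ^ n\<close> by blast
    qed
    have "sum (\<lambda>I. ennreal ((beta (f \<circ> arc_path I))\<^sup>2 * arc_length I powr p)) F =
        (\<Sum>x\<in>P. ennreal ((beta (f \<circ> arc_path (dyadic_arc x)))\<^sup>2 * arc_length (dyadic_arc x) powr p))"
      unfolding P(3) by (subst sum.reindex) (auto intro: inj_on_subset[OF inj_dyadic_arc])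
    also have "\<dots> = (\<Sum>(n, k)\<in>P. ennreal ((beta (f \<circ> arc_path (dyadic_arc (n, k))))\<^sup>2 * w n))"
      by (intro sum.cong) (auto simp: dyadic_arc_def arc_length_def w_def)
    also have "\<dots> \<le> ennreal (10 ^ 7) * (ennreal (w n0 * (2 * l)) + 756 * (\<integral>\<^sup>+z\<in>Q. ennreal ((norm (deriv h z))\<^sup>2 * (4 * V z)) \<partial>lborel))"
    proof (rule sum_beta_square_le[OF f fc h n0 small P(2) _ w0 w1 B])
      show "Q \<in> sets borel" "Q \<subseteq> ball 0 1" by (simp_all add: Q_def carleson_box_subset_ball)
      show "(\<lambda>z. 4 * V z) \<in> borel_measurable borel" by measurable
      show "0 \<le> 4 * V z" for z by (simp add: V_def)
    qed (use nk W in auto)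
    also have "\<dots> \<le> ennreal (10 ^ 7) * (ennreal (w n0 * (2 * l)) + 756 * ennreal (w n0 * (192 * e)))"
      by (intro mult_left_mono add_mono Int) auto
    also have "756 * ennreal (w n0 * (192 * e)) = ennreal (756 * (w n0 * (192 * e)))"
      by (subst (2) ennreal_mult') auto
    also have "ennreal (w n0 * (2 * l)) + \<dots> = ennreal (w n0 * (2 * l) + 756 * (w n0 * (192 * e)))"
      using w0 e l by (intro ennreal_plus[symmetric]) auto
    also have "ennreal (10 ^ 7) * \<dots> = ennreal (10 ^ 7 * (w n0 * (2 * l) + 756 * (w n0 * (192 * e))))"
      using w0 e l by (intro ennreal_mult[symmetric]) auto
    also have "10 ^ 7 * (w n0 * (2 * l) + 756 * (w n0 * (192 * e))) = w n0 * (10 ^ 7 * (2 * l + 145152 * e))"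
      by (simp add: algebra_simps)
    finally show ?thesis .
  qed
  have "(\<Sum>\<^sub>\<infinity>I\<in>{I \<in> dyadic_arcs. arc_set I \<subseteq> arc_set J}. ennreal ((beta (f \<circ> arc_path I))\<^sup>2 * arc_length I powr p))
      \<le> ennreal (w n0 * (10 ^ 7 * (2 * l + 145152 * e)))"
    by (intro infsum_le_finite_sums fin) (auto intro: nonneg_summable_on_complete)
  then have "ennreal (1 / arc_length J powr p) *
      (\<Sum>\<^sub>\<infinity>I\<in>{I \<in> dyadic_arcs. arc_set I \<subseteq> arc_set J}. ennreal ((beta (f \<circ> arc_path I))\<^sup>2 * arc_length I powr p))
     \<le> ennreal (1 / arc_length J powr p) * ennreal (w n0 * (10 ^ 7 * (2 * l + 145152 * e)))"
    by (intro mult_left_mono) auto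
  also have "\<dots> = ennreal (1 / arc_length J powr p * (w n0 * (10 ^ 7 * (2 * l + 145152 * e))))"
    by (intro ennreal_mult'[symmetric]) simp
  also have "1 / arc_length J powr p * (w n0 * (10 ^ 7 * (2 * l + 145152 * e))) = 10 ^ 7 * (2 * l + 145152 * e)"
    using l by (simp add: Jl w_def l_def)
  finally show ?thesis by (simp only: Jl)
qed

subsection \<open>Logarithmic weights\<close>

lemma log_power_nonneg: "0 \<le> log_power p x"
  by (simp add: log_power_def)

lemma log_power_mono: "0 \<le> p \<Longrightarrow> 1 \<le> x \<Longrightarrow> x \<le> y \<Longrightarrow> log_power p x \<le> log_power p y"
  by (auto simp: log_power_def intro!: powr_mono2)

lemma log_power_ge_1:
  assumes "0 \<le> p" "3 \<le> x"
  shows "1 \<le> log_power p x"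
proof -
  have "ln (exp 1) \<le> ln x" using exp_le assms by (subst ln_le_cancel_iff) auto
  then show ?thesis using assms by (auto simp: log_power_def intro!: ge_one_powr_ge_zero)
qed

text \<open>Squaring the argument costs only a constant. This absorbs the factor 9 between arc
  length and height, since 9 / d \<le> (1 / d)^2 for small d > 0.\<close>

lemma log_power_square:
  assumes "0 \<le> p" "1 \<le> x"
  shows "log_power p (x\<^sup>2) = 2 powr p * log_power p x"
  using assms by (simp add: log_power_def ln_realpow powr_mult)

text \<open>The numerator grows at most like n^p, which is eventually below (3/2)^n; (3/4)^n is then
  a majorant.\<close>

lemma summable_log_power:
  assumes p: "0 \<le> p"
  shows "summable (\<lambda>n. log_power p (2 ^ n) / 2 ^ n)"
proof (rule summable_comparison_test_ev)
  show "summable (\<lambda>n. (3/4 :: real) ^ n)" by (intro summable_geometric) simp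
  have "(\<lambda>n::nat. real n powr p * (2/3) ^ n) \<longlonglongrightarrow> 0" by real_asymp
  then have "eventually (\<lambda>n::nat. real n powr p * (2/3) ^ n < 1) sequentially"
    by (intro order_tendstoD) auto
  \<comment> \<open>For p = 0 the index 0 has to be excluded: \<open>log_power\<close> equals 1
    there but \<open>0 powr 0 = 0\<close>.\<close>
  moreover have "eventually (\<lambda>n::nat. 1 \<le> n) sequentially" by (rule eventually_ge_at_top)
  ultimately show "eventually (\<lambda>n. norm (log_power p (2 ^ n) / 2 ^ n) \<le> (3/4) ^ n) sequentially"
  proof eventually_elim
    case (elim n)
    have "ln (2::real) \<le> 1" using ln_le_minus_one[of "2::real"] by simp
    then have "(real n * ln 2) powr p \<le> real n powr p"
      using p by (intro powr_mono2) (auto simp: mult_left_le)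
    then have "log_power p (2 ^ n) \<le> real n powr p"
      using elim by (auto simp: log_power_def ln_realpow)
    then have "log_power p (2 ^ n) * (2/3) ^ n \<le> real n powr p * (2/3) ^ n"
      by (intro mult_right_mono) auto
    then have "log_power p (2 ^ n) * (2/3) ^ n \<le> 1" using elim(1) by linarith
    then have "log_power p (2 ^ n) * (2/3) ^ n * (3/4) ^ n \<le> 1 * (3/4) ^ n"
      by (intro mult_right_mono) auto
    also have "(2/3) ^ n * (3/4) ^ n = (1/2 :: real) ^ n" by (simp flip: power_mult_distrib)
    then have "log_power p (2 ^ n) * (2/3) ^ n * (3/4) ^ n = log_power p (2 ^ n) * (1/2) ^ n"
      by (simp only: mult.assoc)
    also have "\<dots> = log_power p (2 ^ n) / 2 ^ n" by (simp add: power_one_over)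
    finally show ?case by (simp add: log_power_nonneg)
  qed
qed

text \<open>The weighted energy is a finite measure on the disc. The annuli \<open>A n\<close>
  decrease to the empty set, so continuity from above makes their measure tend to 0, uniformly in
  the boundary point.\<close>

lemma D_log_energy_small:
  assumes p: "0 \<le> p" and h: "h \<in> D_log p" and e: "0 < e"
  shows "\<exists>\<delta>>0. \<forall>x r. norm x = 1 \<longrightarrow> 0 < r \<longrightarrow> r \<le> \<delta> \<longrightarrow> energy h (boundary_box x r) \<le> ennreal e"
proof -
  have hol: "h holomorphic_on ball 0 1" using h by (simp add: D_log_def)
  define V where "V = (\<lambda>z::complex. log_power p (1 / (1 - norm z)))"
  have V [measurable]: "V \<in> borel_measurable borel" unfolding V_def log_power_def by measurable
  define G where "G = (\<lambda>z. ennreal ((norm (deriv h z))\<^sup>2 * V z) * indicator (ball 0 1) z)"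
  have [measurable]: "G \<in> borel_measurable borel"
    unfolding G_def by (intro borel_measurable_deriv_weight hol V) auto
  have fin: "(\<integral>\<^sup>+z. G z \<partial>lborel) < \<infinity>" using h by (simp add: D_log_def G_def V_def)
  \<comment> \<open>The shift by 3 gives 1 / (1 - |z|) \<ge> 3 > e on the annuli, so the logarithmic
    weight is at least 1.\<close>
  define A where "A n = {z::complex. 1 - 1 / real (n + 3) \<le> norm z \<and> norm z < 1}" for n
  have [measurable]: "A n \<in> sets borel" for n unfolding A_def by measurable
  have "(\<lambda>n. emeasure (density lborel G) (A n)) \<longlonglongrightarrow> emeasure (density lborel G) (\<Inter>n. A n)"
  proof (rule Lim_emeasure_decseq)
    show "range A \<subseteq> sets (density lborel G)" by auto
    show "decseq A"
    proof (rule decseq_SucI, rule subsetI)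
      fix n z assume "z \<in> A (Suc n)"
      moreover have "1 / real (Suc n + 3) \<le> 1 / real (n + 3)" by (intro divide_left_mono) auto
      ultimately show "z \<in> A n" by (simp add: A_def)
    qed
    show "emeasure (density lborel G) (A n) \<noteq> \<infinity>" for n
    proof -
      have "emeasure (density lborel G) (A n) = (\<integral>\<^sup>+z\<in>A n. G z \<partial>lborel)"
        by (subst emeasure_density) auto
      also have "\<dots> \<le> (\<integral>\<^sup>+z. G z \<partial>lborel)" by (intro nn_integral_mono) (auto simp: indicator_def)
      finally show ?thesis using fin by (simp add: le_less_trans less_top)
    qed
  qed
  also have "(\<Inter>n. A n) = {}"
  proof (intro equals0I)
    fix z assume z: "z \<in> (\<Inter>n. A n)"
    then have "z \<in> A 0" by blast
    then have "0 < 1 - norm z" by (simp add: A_def)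
    then obtain n where "inverse (real (Suc n)) < 1 - norm z" using reals_Archimedean by blast
    moreover have "1 / real (n + 3) \<le> inverse (real (Suc n))" by (simp add: divide_simps)
    moreover have "z \<in> A n" using z by blast
    ultimately show False by (simp add: A_def)
  qed
  finally have "(\<lambda>n. emeasure (density lborel G) (A n)) \<longlonglongrightarrow> 0" by simp
  then have "eventually (\<lambda>n. emeasure (density lborel G) (A n) < ennreal e) sequentially"
    using e by (intro order_tendstoD) auto
  then obtain n where n: "emeasure (density lborel G) (A n) < ennreal e"
    by (auto simp: eventually_sequentially)
  show ?thesis
  \<comment> \<open>Points of \<open>boundary_box x r\<close> have height at most 9 r; this choice
    puts the box inside \<open>A n\<close>.\<close>
  proof (intro exI[of _ "1 / (9 * real (n + 3))"] conjI allI impI)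
    fix x :: complex and r :: real
    assume x: "norm x = 1" and r: "0 < r" "r \<le> 1 / (9 * real (n + 3))"
    have "energy h (boundary_box x r) \<le> (\<integral>\<^sup>+z\<in>A n. G z \<partial>lborel)"
      unfolding energy_def
    proof (intro nn_integral_mono)
      fix z
      show "ennreal ((norm (deriv h z))\<^sup>2) * indicator (boundary_box x r) z \<le> G z * indicator (A n) z"
      proof (cases "z \<in> boundary_box x r")
        case True
        have d: "0 < 1 - norm z" "1 - norm z \<le> 9 * r"
          using True r norm_triangle_ineq2[of x z] x by (auto simp: boundary_box_def dist_norm)
        have "9 * r \<le> 1 / real (n + 3)" using r(2) by (simp add: divide_simps mult_ac)
        then have dn: "1 - norm z \<le> 1 / real (n + 3)" using d by linarith
        also have "\<dots> \<le> 1 / 3" by (intro divide_left_mono) auto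
        finally have "3 \<le> 1 / (1 - norm z)" using d by (simp add: pos_le_divide_eq)
        then have "1 \<le> V z" unfolding V_def by (rule log_power_ge_1[OF p])
        then have "(norm (deriv h z))\<^sup>2 * 1 \<le> (norm (deriv h z))\<^sup>2 * V z" by (intro mult_left_mono) auto
        then show ?thesis using True d dn by (simp add: G_def A_def ennreal_leI)
      qed simp
    qed
    also have "\<dots> = emeasure (density lborel G) (A n)" by (subst emeasure_density) auto
    finally show "energy h (boundary_box x r) \<le> ennreal e" using n by simp
  qed simp
qed

text \<open>The weights increase with n, so the doubling condition is immediate. Arcs finer than
  scale \<open>n0\<close> are treated with \<open>Q\<close> the whole disc; the finitely many
  coarser ones contribute a finite amount.\<close>

lemma D_log_beta_sum_finite:
  assumes f: "f holomorphic_on ball 0 1" and fc: "continuous_on (cball 0 1) f"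
    and h: "log_deriv_branch f h" and p: "0 \<le> p" and hD: "h \<in> D_log p"
  shows "(\<Sum>\<^sub>\<infinity>I\<in>dyadic_arcs. ennreal ((beta (f \<circ> arc_path I))\<^sup>2 * log_power p (1 / arc_length I))) < \<infinity>"
proof -
  have h': "h holomorphic_on ball 0 1" using h by (simp add: log_deriv_branch_def)
  obtain \<delta> where \<delta>: "0 < \<delta>"
    "\<And>x r. norm x = 1 \<Longrightarrow> 0 < r \<Longrightarrow> r \<le> \<delta> \<Longrightarrow> energy h (boundary_box x r) \<le> ennreal (1 / 31360000)"
    using D_log_energy_small[OF p hD, of "1 / 31360000"] by auto
  obtain n1 where n1: "(1/2) ^ n1 < \<delta>" using real_arch_pow_inv[OF \<delta>(1), of "1/2"] by auto
  \<comment> \<open>From scale 7 on, 9 / 2^m \<le> 1/9, as 81 \<le> 2^7.\<close>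
  define n0 where "n0 = max 7 n1"
  have "(1 / 2 ^ n0 :: real) \<le> 1 / 2 ^ n1" by (intro divide_left_mono power_increasing) (auto simp: n0_def)
  then have n0: "7 \<le> n0" "1 / 2 ^ n0 \<le> \<delta>" using n1 by (auto simp: n0_def power_divide)
  define w where "w n = log_power p (2 ^ n)" for n :: nat
  have w0: "0 \<le> w n" for n by (simp add: w_def log_power_nonneg)
  have w1: "w n \<le> 2 ^ j * w (n + j)" for n j
  proof -
    have "w n \<le> 1 * w (n + j)"
      using p unfolding w_def mult_1 by (intro log_power_mono power_increasing) auto
    also have "\<dots> \<le> 2 ^ j * w (n + j)" by (intro mult_right_mono w0) simp
    finally show ?thesis .
  qed
  define B where "B = (\<Sum>n. w n / 2 ^ n)"
  have B: "(\<Sum>n\<in>N. w n / 2 ^ n) \<le> B" if "finite N" for N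
    unfolding B_def using summable_log_power[OF p] w0 that unfolding w_def by (intro sum_le_suminf) auto
  define V where "V = (\<lambda>z::complex. log_power p (1 / (1 - norm z)))"
  have V [measurable]: "V \<in> borel_measurable borel" unfolding V_def log_power_def by measurable
  \<comment> \<open>At height d with 2^m d \<le> 9 and d \<le> 1/9 one has 2^m \<le> 1 / d^2, and
    \<open>log_power_square\<close> applies.\<close>
  have W: "w m \<le> 2 powr p * V z"
    if z: "norm z < 1" and m: "n0 \<le> m" "1 - norm z \<le> 9 * (1 / 2 ^ m)" for m and z :: complex
  proof -
    define d where "d = 1 - norm z"
    have d: "0 < d" "d \<le> 9 * (1 / 2 ^ m)" using z m by (simp_all add: d_def)
    have "(2::real) ^ 7 \<le> 2 ^ m" using n0 m by (intro power_increasing) auto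
    then have "9 * (1 / 2 ^ m) \<le> (1 / 9 :: real)" by (simp add: divide_simps)
    then have d9: "d \<le> 1 / 9" using d by linarith
    have "2 ^ m * d \<le> 9" using d(2) by (simp add: field_simps)
    then have "2 ^ m * d * d \<le> 9 * (1 / 9)" using d d9 by (intro mult_mono) auto
    then have "2 ^ m \<le> (1 / d)\<^sup>2" using d by (simp add: power2_eq_square field_simps)
    then have "w m \<le> log_power p ((1 / d)\<^sup>2)" unfolding w_def using p by (intro log_power_mono) auto
    also have "\<dots> = 2 powr p * V z"
      unfolding V_def d_def[symmetric] using p d d9 by (intro log_power_square) auto
    finally show ?thesis .
  qed
  define I0 where "I0 = (\<integral>\<^sup>+z\<in>ball 0 1. ennreal ((norm (deriv h z))\<^sup>2 * (2 powr p * V z)) \<partial>lborel)"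
  have "I0 = ennreal (2 powr p) * (\<integral>\<^sup>+z\<in>ball 0 1. ennreal ((norm (deriv h z))\<^sup>2 * V z) \<partial>lborel)"
    unfolding I0_def by (intro nn_integral_deriv_weight_cmult h' V) auto
  also have "\<dots> < \<infinity>" using hD by (simp add: D_log_def V_def ennreal_mult_less_top)
  finally have I0: "I0 < \<infinity>" .
  define F0 where "F0 = (\<lambda>I. ennreal ((beta (f \<circ> arc_path I))\<^sup>2 * log_power p (1 / arc_length I)))"
  define L where "L = dyadic_arc ` (Sigma {..<n0} (\<lambda>n. {..<2 ^ n}))"
  have L: "finite L" by (simp add: L_def)
  define C where "C = sum F0 L + ennreal (10 ^ 7) * (ennreal B + 756 * I0)"
  have fin: "sum F0 F \<le> C" if F: "finite F" "F \<subseteq> dyadic_arcs" for F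
  proof -
    obtain P where P: "P \<subseteq> {(n, k). 1 \<le> n \<and> k < 2 ^ n}" "finite P" "F = dyadic_arc ` P"
      using finite_subset_image[OF F(1), of dyadic_arc "{(n, k). 1 \<le> n \<and> k < 2 ^ n}"] F(2) dyadic_arcs_eq by blast
    define P' where "P' = {x \<in> P. n0 \<le> fst x}"
    have P': "finite P'" using P by (simp add: P'_def)
    have nk: "n0 \<le> n \<and> k < 2 ^ n" if "(n, k) \<in> P'" for n k
      using that P(1) by (auto simp: P'_def)
    have "F \<subseteq> L \<union> dyadic_arc ` P'"
      using P by (force simp: L_def P'_def)
    then have "sum F0 F \<le> sum F0 (L \<union> dyadic_arc ` P')"
      using L P' by (intro sum_mono2) auto
    also have "\<dots> \<le> sum F0 L + sum F0 (dyadic_arc ` P')"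
      using L P' by (subst sum.union_inter[symmetric]) auto
    also have "sum F0 (dyadic_arc ` P') = (\<Sum>x\<in>P'. F0 (dyadic_arc x))"
      by (subst sum.reindex) (auto intro: inj_on_subset[OF inj_dyadic_arc])
    also have "\<dots> = (\<Sum>(n, k)\<in>P'. ennreal ((beta (f \<circ> arc_path (dyadic_arc (n, k))))\<^sup>2 * w n))"
      by (intro sum.cong) (auto simp: F0_def dyadic_arc_def arc_length_def w_def)
    also have "\<dots> \<le> ennreal (10 ^ 7) * (ennreal B + 756 * I0)"
      unfolding I0_def
    proof (rule sum_beta_square_le[OF f fc h _ _ P' nk w0 w1 B])
      show "energy h (boundary_box x r) \<le> ennreal (1 / 31360000)"
        if "norm x = 1" "0 < r" "r \<le> 1 / 2 ^ n0" for x r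
        using that n0 by (intro \<delta>) auto
      show "arc_layer (real k / 2 ^ n) (1 / 2 ^ n) j \<subseteq> ball 0 1" for n k j
      proof
        fix z assume "z \<in> arc_layer (real k / 2 ^ n) (1 / 2 ^ n) j"
        then have "1 / 2 ^ n / 2 ^ j / 4 \<le> 1 - norm z" by (simp only: arc_layer_def mem_Collect_eq)
        moreover have "(0::real) < 1 / 2 ^ n / 2 ^ j / 4" by simp
        ultimately have "norm z < 1" by linarith
        then show "z \<in> ball 0 1" by simp
      qed
      show "(\<lambda>z. 2 powr p * V z) \<in> borel_measurable borel" by measurable
      show "0 \<le> 2 powr p * V z" for z by (simp add: V_def log_power_nonneg)
    qed (use n0 W in auto)
    finally show ?thesis by (simp add: C_def)
  qed
  have "infsum F0 dyadic_arcs \<le> C"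
    by (intro infsum_le_finite_sums fin) (auto intro: nonneg_summable_on_complete)
  also have "C < \<infinity>" using I0 L by (simp add: C_def F0_def ennreal_mult_less_top)
  finally show ?thesis unfolding F0_def .
qed

section \<open>Conclusion for both classes of curves\<close>

theorem theorem3:
  fixes \<Gamma> :: "complex set" and f h :: "complex \<Rightarrow> complex"
  assumes "closed_jordan_curve \<Gamma>"
    and "conformal_onto f (ball 0 1) (inside \<Gamma>)"
    and "\<exists>g. homeomorphism (cball 0 1) (closure (inside \<Gamma>)) f g"
    and "log_deriv_branch f h"
  shows "(\<forall>p::real. 0 < p \<and> p \<le> 1 \<and> h \<in> Q_p0 p \<longrightarrow>
            ((\<lambda>\<delta>. SUP J\<in>{J \<in> dyadic_arcs. arc_length J \<le> \<delta>}.
                ennreal (1 / arc_length J powr p) *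
                (\<Sum>\<^sub>\<infinity>I\<in>{I \<in> dyadic_arcs. arc_set I \<subseteq> arc_set J}.
                   ennreal ((beta (f \<circ> arc_path I))\<^sup>2 * arc_length I powr p)))
              \<longlongrightarrow> 0) (at_right 0)) \<and>
         (\<forall>p::real. 0 \<le> p \<and> h \<in> D_log p \<longrightarrow>
            (\<Sum>\<^sub>\<infinity>I\<in>dyadic_arcs.
               ennreal ((beta (f \<circ> arc_path I))\<^sup>2 * log_power p (1 / arc_length I))) < \<infinity>)"
proof (intro conjI allI impI)
  have f: "f holomorphic_on ball 0 1" using assms(2) by (simp add: conformal_onto_def)
  have fc: "continuous_on (cball 0 1) f" using assms(3) by (auto simp: homeomorphism_def)
  note h = assms(4)
  {
    fix p :: real assume "0 \<le> p \<and> h \<in> D_log p"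
    then show "(\<Sum>\<^sub>\<infinity>I\<in>dyadic_arcs. ennreal ((beta (f \<circ> arc_path I))\<^sup>2 * log_power p (1 / arc_length I))) < \<infinity>"
      using D_log_beta_sum_finite[OF f fc h] by blast
  next
    fix p :: real assume p: "0 < p \<and> p \<le> 1 \<and> h \<in> Q_p0 p"
    let ?box = "\<lambda>I. ennreal (1 / arc_length I powr p) *
         (\<integral>\<^sup>+z\<in>carleson_box I. ennreal ((norm (deriv h z))\<^sup>2 * (1 - (norm z)\<^sup>2) powr p) \<partial>lborel)"
    let ?S = "\<lambda>J. ennreal (1 / arc_length J powr p) *
                (\<Sum>\<^sub>\<infinity>I\<in>{I \<in> dyadic_arcs. arc_set I \<subseteq> arc_set J}.
                   ennreal ((beta (f \<circ> arc_path I))\<^sup>2 * arc_length I powr p))"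
    have lim: "((\<lambda>\<delta>. SUP I\<in>{I \<in> circle_arcs. arc_length I \<le> \<delta>}. ?box I) \<longlongrightarrow> 0) (at_right 0)"
      using p by (simp add: Q_p0_def)
    show "((\<lambda>\<delta>. SUP J\<in>{J \<in> dyadic_arcs. arc_length J \<le> \<delta>}. ?S J) \<longlongrightarrow> 0) (at_right 0)"
    proof (rule tendsto_zero_ennreal)
      fix r :: real assume r: "0 < r"
      \<comment> \<open>As 145152 * 10^7 < 1.5 * 10^12, the energy term will stay below 0.15 r; the
        other bound is required by \<open>Q_p0_beta_sum_le\<close>.\<close>
      define e where "e = min (1 / 10 ^ 10) (r / 10 ^ 13)"
      have e: "0 < e" "e \<le> 1 / 10 ^ 10" "e \<le> r / 10 ^ 13" using r unfolding e_def by auto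
      have "eventually (\<lambda>\<delta>. (SUP I\<in>{I \<in> circle_arcs. arc_length I \<le> \<delta>}. ?box I) < ennreal e) (at_right 0)"
        using lim e by (intro order_tendstoD) auto
      then obtain b where b: "0 < b" "\<And>\<delta>. 0 < \<delta> \<Longrightarrow> \<delta> < b \<Longrightarrow> (SUP I\<in>{I \<in> circle_arcs. arc_length I \<le> \<delta>}. ?box I) < ennreal e"
        by (auto simp: eventually_at_right_field)
      \<comment> \<open>The eventual bound holds strictly below \<open>b\<close>, hence at
        \<open>b / 2\<close>.\<close>
      have box: "?box I \<le> ennreal e" if "I \<in> circle_arcs" "arc_length I \<le> b / 2" for I
      proof -
        have "?box I \<le> (SUP I\<in>{I \<in> circle_arcs. arc_length I \<le> b / 2}. ?box I)"
          using that by (intro SUP_upper) simp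
        also have "\<dots> < ennreal e" by (rule b(2)) (use b(1) in auto)
        finally show ?thesis by simp
      qed
      \<comment> \<open>The first two bounds admit boxes of length 48 |J|; the third keeps the
        curvature term 2 * 10^7 |J| below r/5.\<close>
      define c where "c = Min {b / 96, 1 / 48, r / 10 ^ 8}"
      have c: "0 < c" "48 * c \<le> b / 2" "48 * c \<le> 1" "c \<le> r / 10 ^ 8" using b r by (auto simp: c_def)
      have "(SUP J\<in>{J \<in> dyadic_arcs. arc_length J \<le> \<delta>}. ?S J) < ennreal r" if \<delta>: "0 < \<delta>" "\<delta> < c" for \<delta>
      proof -
        have "(SUP J\<in>{J \<in> dyadic_arcs. arc_length J \<le> \<delta>}. ?S J) \<le> ennreal (10 ^ 7 * (2 * \<delta> + 145152 * e))"
        proof (rule SUP_least)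
          fix J assume J: "J \<in> {J \<in> dyadic_arcs. arc_length J \<le> \<delta>}"
          have "?S J \<le> ennreal (10 ^ 7 * (2 * arc_length J + 145152 * e))"
            using J \<delta> c p by (intro Q_p0_beta_sum_le[OF f fc h _ _ e(1,2) box]) auto
          also have "\<dots> \<le> ennreal (10 ^ 7 * (2 * \<delta> + 145152 * e))" using J by (intro ennreal_leI) simp
          finally show "?S J \<le> ennreal (10 ^ 7 * (2 * \<delta> + 145152 * e))" .
        qed
        also have "10 ^ 7 * (2 * \<delta> + 145152 * e) < r" using \<delta> c e r by simp
        then have "ennreal (10 ^ 7 * (2 * \<delta> + 145152 * e)) < ennreal r" using r by (intro ennreal_lessI) auto
        finally show ?thesis .
      qed
      then show "eventually (\<lambda>\<delta>. (SUP J\<in>{J \<in> dyadic_arcs. arc_length J \<le> \<delta>}. ?S J) < ennreal r) (at_right 0)"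
        using c(1) by (auto simp: eventually_at_right_field)
    qed
  }
qed

end
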